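(* Let $m$ be a refinement mapping from a high-level BAT $\mathcal{D}_h$ to a low-level BAT $\mathcal{D}_l$, and suppose that for any distinct ground high-level action terms $\alpha$ and $\alpha'$: (a) $\mathcal{D}_l\cup\mathcal{C}\models\forall s,s'.\,Do(m(\alpha),s,s')\supset\neg\exists\delta.\,Trans^*(m(\alpha'),s,\delta,s')$; (b) $\mathcal{D}_l\cup\mathcal{C}\models\forall s,s'.\,Do(m(\alpha),s,s')\supset\neg\exists a\exists\delta.\,Trans^*(m(\alpha),s,\delta,do(a,s'))$; (c) $\mathcal{D}_l\cup\mathcal{C}\models\forall s,s'.\,Do(m(\alpha),s,s')\supset s<s'$. Let $M_l$ be a model of $\mathcal{D}_l\cup\mathcal{C}$. Then for any ground situation terms $S_s$ and $S_e$ such that $M_l\models Do(\textsc{anyseqhl},S_s,S_e)$, there exists a unique ground high-level action sequence $\vec\alpha$ such that $M_l\models Do(m(\vec\alpha),S_s,S_e)$.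
   Context: Situation calculus setting. The object sort consists of a countably infinite set $\mathcal{N}$ of standard names (unique names and domain closure for objects); there are no function symbols other than constants and no non-fluent predicates. Situations are built from the initial situation $S_0$ with $do(a,s)$; $do([a_1,\dots,a_n],s)$ abbreviates $do(a_n,\dots,do(a_1,s)\dots)$, also written $do(\vec a,s)$; $\epsilon$ is the empty sequence. Fluents are predicates whose last argument is a situation. $Poss(a,s)$ means $a$ is executable in $s$; $Executable(s)$ means every action along the history from $S_0$ to $s$ was possible where performed; $s<s'$ means $s'$ is obtained from $s$ by a nonempty sequence of actions each possible where performed, and $s\le s'$ means $s=s'\lor s<s'$. A formula is uniform in $s$ if it does not mention $Poss$ or $\sqsubset$, does not quantify over situations, does not use equality on situations, and its only situation term in fluent situation-argument positions is $s$. A basic action theory (BAT) over finitely many action types $\mathcal{A}$ and fluents $\mathcal{F}$ is the union of: $\mathcal{D}_{S_0}$ (first-order axioms about $S_0$); $\mathcal{D}_{poss}$, one axiom $Poss(A(\vec x),s)\equiv\phi^{Poss}_A(\vec x,s)$ per action type, uniform in $s$; $\mathcal{D}_{ssa}$, one successor state axiom $F(\vec x,do(a,s))\equiv\phi^{ssa}_F(\vec x,a,s)$ per fluent, uniform in $s$; $\mathcal{D}_{ca}$, unique names for actions and domain closure on action types; $\mathcal{D}_{coa}$, unique names and domain closure for the constants in $\mathcal{N}$; and $\Sigma$, the foundational axioms of the situation calculus. A situation-suppressed formula omits situation arguments of fluents; $\phi[s]$ restores $s$. ConGolog programs: $\delta::=\alpha\mid\varphi?\mid\delta_1;\delta_2\mid\delta_1|\delta_2\mid\pi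 x.\delta\mid\delta^*\mid\delta_1\|\delta_2$; $nil$ abbreviates $True?$. Programs are encoded as terms and $\mathcal{C}$ denotes the axioms: $Trans(\alpha,s,\delta',s')\equiv s'=do(\alpha,s)\land Poss(\alpha,s)\land\delta'=True?$; $Trans(\varphi?,s,\delta',s')\equiv False$; $Trans(\delta_1;\delta_2,s,\delta',s')\equiv\exists\delta_1'(Trans(\delta_1,s,\delta_1',s')\land\delta'=\delta_1';\delta_2)\lor(Final(\delta_1,s)\land Trans(\delta_2,s,\delta',s'))$; $Trans(\delta_1|\delta_2,s,\delta',s')\equiv Trans(\delta_1,s,\delta',s')\lor Trans(\delta_2,s,\delta',s')$; $Trans(\pi x.\delta,s,\delta',s')\equiv\exists x.Trans(\delta,s,\delta',s')$; $Trans(\delta^*,s,\delta',s')\equiv\exists\delta''(Trans(\delta,s,\delta'',s')\land\delta'=\delta'';\delta^* )$; $Trans(\delta_1\|\delta_2,s,\delta',s')\equiv\exists\delta_1'(Trans(\delta_1,s,\delta_1',s')\land\delta'=\delta_1'\|\delta_2)\lor\exists\delta_2'(Trans(\delta_2,s,\delta_2',s')\land\delta'=\delta_1\|\delta_2')$; $Final(\alpha,s)\equiv False$; $Final(\varphi?,s)\equiv\varphi[s]$; $Final(\delta_1;\delta_2,s)\equiv Final(\delta_1,s)\land Final(\delta_2,s)$; $Final(\delta_1|\delta_2,s)\equiv Final(\delta_1,s)\lor Final(\delta_2,s)$; $Final(\pi x.\delta,s)\equiv\exists x.Final(\delta,s)$; $Final(\delta^*,s)\equiv True$; $Final(\delta_1\|\delta_2,s)\equiv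 Final(\delta_1,s)\land Final(\delta_2,s)$. $Trans^*$ is the reflexive transitive closure of $Trans$, and $Do(\delta,s,s')\doteq\exists\delta'.Trans^*(\delta,s,\delta',s')\land Final(\delta',s')$. A program $\delta$ is situation-determined in $s$ if $Trans^*(\delta,s,\delta',s')\land Trans^*(\delta,s,\delta'',s')$ implies $\delta'=\delta''$. Refinement mapping: $\mathcal{D}_h$, $\mathcal{D}_l$ are BATs with action types $\mathcal{A}_h,\mathcal{A}_l$ and fluents $\mathcal{F}_h,\mathcal{F}_l$, sharing no domain-specific symbols except $\mathcal{N}$. $m$ assigns to each $A\in\mathcal{A}_h$ a situation-determined ConGolog program $m(A(\vec x))$ over the language of $\mathcal{D}_l$ with free variables $\vec x$, and to each $F\in\mathcal{F}_h$ a situation-suppressed low-level formula $m(F(\vec x))$ with free variables $\vec x$; $m(\phi)$ substitutes $m(F(\vec x))$ for fluent atoms; $m(\alpha_1,\dots,\alpha_n)=m(\alpha_1);\dots;m(\alpha_n)$, $m(\epsilon)=nil$. $\textsc{any1hl}\doteq|_{A_i\in\mathcal{A}_h}\pi\vec x.\,m(A_i(\vec x))$ and $\textsc{anyseqhl}\doteq\textsc{any1hl}^*$. *)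

theory Defs
  imports Main "HOL-Library.Countable" "HOL-Library.Infinite_Typeclass"
begin

section \<open>Syntax\<close>

record ('act, 'fl) signature =
  act_types :: "'act list"
  act_arity :: "'act \<Rightarrow> nat"
  fluents :: "'fl list"
  fl_arity :: "'fl \<Rightarrow> nat"

definition wf_signature :: "('act, 'fl) signature \<Rightarrow> bool" where
  "wf_signature L \<longleftrightarrow> distinct (act_types L) \<and> distinct (fluents L)"

text \<open>
  Object and action variables are two families indexed by natural numbers. The type \<open>'c\<close> of
  object constants is the set of standard names for the syntax proper; with \<open>'c\<close> the object
  domain of a structure, the same datatypes are the expressions with parameters from that domain.
\<close>

datatype 'c oterm = OVar nat | Const 'c

datatype ('c, 'act) aterm = AVar nat | Act 'act "'c oterm list"

text \<open>
  Situation-suppressed formulas. Restoring a situation \<open>s\<close> gives exactly the formulas uniform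
  in \<open>s\<close>: no \<open>Poss\<close>, no ordering, no equality or quantification on situations.
\<close>

datatype ('c, 'act, 'fl) fm =
    Tru
  | Fluent 'fl "'c oterm list"
  | EqO "'c oterm" "'c oterm"
  | EqA "('c, 'act) aterm" "('c, 'act) aterm"
  | Neg "('c, 'act, 'fl) fm"
  | Conj "('c, 'act, 'fl) fm" "('c, 'act, 'fl) fm"
  | ExO nat "('c, 'act, 'fl) fm"
  | ExA nat "('c, 'act, 'fl) fm"

datatype ('c, 'act, 'fl) prog =
    Prim "('c, 'act) aterm"
  | Test "('c, 'act, 'fl) fm"
  | Seq "('c, 'act, 'fl) prog" "('c, 'act, 'fl) prog"
  | Choice "('c, 'act, 'fl) prog" "('c, 'act, 'fl) prog"
  | PiO nat "('c, 'act, 'fl) prog"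
  | PiA nat "('c, 'act, 'fl) prog"
  | Star "('c, 'act, 'fl) prog"
  | Conc "('c, 'act, 'fl) prog" "('c, 'act, 'fl) prog"

abbreviation nil :: "('c, 'act, 'fl) prog" where
  "nil \<equiv> Test Tru"

text \<open>
  Well-formedness over \<open>L\<close>, with free object variables in \<open>X\<close> and free action variables in \<open>Y\<close>.
\<close>

primrec wf_oterm :: "nat set \<Rightarrow> 'c oterm \<Rightarrow> bool" where
  "wf_oterm X (OVar x) \<longleftrightarrow> x \<in> X"
| "wf_oterm X (Const c) \<longleftrightarrow> True"

primrec wf_aterm ::
  "('act, 'fl) signature \<Rightarrow> nat set \<Rightarrow> nat set \<Rightarrow> ('c, 'act) aterm \<Rightarrow> bool" where
  "wf_aterm L X Y (AVar a) \<longleftrightarrow> a \<in> Y"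
| "wf_aterm L X Y (Act A ts) \<longleftrightarrow>
     A \<in> set (act_types L) \<and> length ts = act_arity L A \<and> (\<forall>t\<in>set ts. wf_oterm X t)"

primrec wf_fm ::
  "('act, 'fl) signature \<Rightarrow> nat set \<Rightarrow> nat set \<Rightarrow> ('c, 'act, 'fl) fm \<Rightarrow> bool" where
  "wf_fm L X Y Tru \<longleftrightarrow> True"
| "wf_fm L X Y (Fluent F ts) \<longleftrightarrow>
     F \<in> set (fluents L) \<and> length ts = fl_arity L F \<and> (\<forall>t\<in>set ts. wf_oterm X t)"
| "wf_fm L X Y (EqO t u) \<longleftrightarrow> wf_oterm X t \<and> wf_oterm X u"
| "wf_fm L X Y (EqA t u) \<longleftrightarrow> wf_aterm L X Y t \<and> wf_aterm L X Y u"
| "wf_fm L X Y (Neg \<phi>) \<longleftrightarrow> wf_fm L X Y \<phi>"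
| "wf_fm L X Y (Conj \<phi> \<psi>) \<longleftrightarrow> wf_fm L X Y \<phi> \<and> wf_fm L X Y \<psi>"
| "wf_fm L X Y (ExO x \<phi>) \<longleftrightarrow> wf_fm L (insert x X) Y \<phi>"
| "wf_fm L X Y (ExA a \<phi>) \<longleftrightarrow> wf_fm L X (insert a Y) \<phi>"

primrec wf_prog ::
  "('act, 'fl) signature \<Rightarrow> nat set \<Rightarrow> nat set \<Rightarrow> ('c, 'act, 'fl) prog \<Rightarrow> bool" where
  "wf_prog L X Y (Prim \<alpha>) \<longleftrightarrow> wf_aterm L X Y \<alpha>"
| "wf_prog L X Y (Test \<phi>) \<longleftrightarrow> wf_fm L X Y \<phi>"
| "wf_prog L X Y (Seq \<delta>\<^sub>1 \<delta>\<^sub>2) \<longleftrightarrow> wf_prog L X Y \<delta>\<^sub>1 \<and> wf_prog L X Y \<delta>\<^sub>2"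
| "wf_prog L X Y (Choice \<delta>\<^sub>1 \<delta>\<^sub>2) \<longleftrightarrow> wf_prog L X Y \<delta>\<^sub>1 \<and> wf_prog L X Y \<delta>\<^sub>2"
| "wf_prog L X Y (PiO x \<delta>) \<longleftrightarrow> wf_prog L (insert x X) Y \<delta>"
| "wf_prog L X Y (PiA a \<delta>) \<longleftrightarrow> wf_prog L X (insert a Y) \<delta>"
| "wf_prog L X Y (Star \<delta>) \<longleftrightarrow> wf_prog L X Y \<delta>"
| "wf_prog L X Y (Conc \<delta>\<^sub>1 \<delta>\<^sub>2) \<longleftrightarrow> wf_prog L X Y \<delta>\<^sub>1 \<and> wf_prog L X Y \<delta>\<^sub>2"

definition closed_progs :: "('act, 'fl) signature \<Rightarrow> ('c, 'act, 'fl) prog set" where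
  "closed_progs L = {\<delta>. wf_prog L {} {} \<delta>}"

text \<open>
  Simultaneous substitution of constants for object variables (\<open>\<sigma>\<close>) and of ground action terms
  for action variables (\<open>\<tau>\<close>). No variables are inserted, so there is no capture.
\<close>

primrec subst_oterm :: "(nat \<rightharpoonup> 'c) \<Rightarrow> 'c oterm \<Rightarrow> 'c oterm" where
  "subst_oterm \<sigma> (OVar x) = (case \<sigma> x of None \<Rightarrow> OVar x | Some c \<Rightarrow> Const c)"
| "subst_oterm \<sigma> (Const c) = Const c"

primrec subst_aterm ::
  "(nat \<rightharpoonup> 'c) \<Rightarrow> (nat \<rightharpoonup> 'act \<times> 'c list) \<Rightarrow> ('c, 'act) aterm \<Rightarrow> ('c, 'act) aterm" where
  "subst_aterm \<sigma> \<tau> (AVar a) =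
     (case \<tau> a of None \<Rightarrow> AVar a | Some (A, cs) \<Rightarrow> Act A (map Const cs))"
| "subst_aterm \<sigma> \<tau> (Act A ts) = Act A (map (subst_oterm \<sigma>) ts)"

primrec subst_fm ::
  "(nat \<rightharpoonup> 'c) \<Rightarrow> (nat \<rightharpoonup> 'act \<times> 'c list) \<Rightarrow> ('c, 'act, 'fl) fm \<Rightarrow> ('c, 'act, 'fl) fm" where
  "subst_fm \<sigma> \<tau> Tru = Tru"
| "subst_fm \<sigma> \<tau> (Fluent F ts) = Fluent F (map (subst_oterm \<sigma>) ts)"
| "subst_fm \<sigma> \<tau> (EqO t u) = EqO (subst_oterm \<sigma> t) (subst_oterm \<sigma> u)"
| "subst_fm \<sigma> \<tau> (EqA t u) = EqA (subst_aterm \<sigma> \<tau> t) (subst_aterm \<sigma> \<tau> u)"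
| "subst_fm \<sigma> \<tau> (Neg \<phi>) = Neg (subst_fm \<sigma> \<tau> \<phi>)"
| "subst_fm \<sigma> \<tau> (Conj \<phi> \<psi>) = Conj (subst_fm \<sigma> \<tau> \<phi>) (subst_fm \<sigma> \<tau> \<psi>)"
| "subst_fm \<sigma> \<tau> (ExO x \<phi>) = ExO x (subst_fm (\<sigma>(x := None)) \<tau> \<phi>)"
| "subst_fm \<sigma> \<tau> (ExA a \<phi>) = ExA a (subst_fm \<sigma> (\<tau>(a := None)) \<phi>)"

primrec subst_prog ::
  "(nat \<rightharpoonup> 'c) \<Rightarrow> (nat \<rightharpoonup> 'act \<times> 'c list) \<Rightarrow> ('c, 'act, 'fl) prog \<Rightarrow> ('c, 'act, 'fl) prog" where
  "subst_prog \<sigma> \<tau> (Prim \<alpha>) = Prim (subst_aterm \<sigma> \<tau> \<alpha>)"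
| "subst_prog \<sigma> \<tau> (Test \<phi>) = Test (subst_fm \<sigma> \<tau> \<phi>)"
| "subst_prog \<sigma> \<tau> (Seq \<delta>\<^sub>1 \<delta>\<^sub>2) = Seq (subst_prog \<sigma> \<tau> \<delta>\<^sub>1) (subst_prog \<sigma> \<tau> \<delta>\<^sub>2)"
| "subst_prog \<sigma> \<tau> (Choice \<delta>\<^sub>1 \<delta>\<^sub>2) = Choice (subst_prog \<sigma> \<tau> \<delta>\<^sub>1) (subst_prog \<sigma> \<tau> \<delta>\<^sub>2)"
| "subst_prog \<sigma> \<tau> (PiO x \<delta>) = PiO x (subst_prog (\<sigma>(x := None)) \<tau> \<delta>)"
| "subst_prog \<sigma> \<tau> (PiA a \<delta>) = PiA a (subst_prog \<sigma> (\<tau>(a := None)) \<delta>)"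
| "subst_prog \<sigma> \<tau> (Star \<delta>) = Star (subst_prog \<sigma> \<tau> \<delta>)"
| "subst_prog \<sigma> \<tau> (Conc \<delta>\<^sub>1 \<delta>\<^sub>2) = Conc (subst_prog \<sigma> \<tau> \<delta>\<^sub>1) (subst_prog \<sigma> \<tau> \<delta>\<^sub>2)"

text \<open>The formal parameters of a \<open>k\<close>-ary action type or fluent are the object variables \<open>0, \<dots>, k - 1\<close>.\<close>

definition inst_prog :: "'c list \<Rightarrow> ('c, 'act, 'fl) prog \<Rightarrow> ('c, 'act, 'fl) prog" where
  "inst_prog cs \<delta> = subst_prog (\<lambda>x. if x < length cs then Some (cs ! x) else None) Map.empty \<delta>"

definition pis :: "nat \<Rightarrow> ('c, 'act, 'fl) prog \<Rightarrow> ('c, 'act, 'fl) prog" where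
  "pis k \<delta> = foldr PiO [0..<k] \<delta>"

fun choices :: "('c, 'act, 'fl) prog list \<Rightarrow> ('c, 'act, 'fl) prog" where
  "choices [] = Test (Neg Tru)"
| "choices [\<delta>] = \<delta>"
| "choices (\<delta> # \<delta>' # \<delta>s) = Choice \<delta> (choices (\<delta>' # \<delta>s))"

fun seqs :: "('c, 'act, 'fl) prog list \<Rightarrow> ('c, 'act, 'fl) prog" where
  "seqs [] = nil"
| "seqs [\<delta>] = \<delta>"
| "seqs (\<delta> # \<delta>' # \<delta>s) = Seq \<delta> (seqs (\<delta>' # \<delta>s))"

type_synonym ('n, 'act) gaction = "'act \<times> 'n list"

definition ground_actions :: "('act, 'fl) signature \<Rightarrow> ('n, 'act) gaction set" where
  "ground_actions L = {(A, ns). A \<in> set (act_types L) \<and> length ns = act_arity L A}"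

datatype ('n, 'act) gsit = Init | Do_act "('n, 'act) gaction" "('n, 'act) gsit"

primrec ground_sit :: "('act, 'fl) signature \<Rightarrow> ('n, 'act) gsit \<Rightarrow> bool" where
  "ground_sit L Init \<longleftrightarrow> True"
| "ground_sit L (Do_act \<alpha> S) \<longleftrightarrow> \<alpha> \<in> ground_actions L \<and> ground_sit L S"

section \<open>Basic action theories\<close>

text \<open>
  \<open>poss_fm A\<close> and \<open>ssa_fm F\<close> are the right-hand sides of the precondition and successor state
  axioms; in \<open>ssa_fm F\<close> the action variable \<open>0\<close> stands for the action performed.
\<close>

record ('n, 'act, 'fl) bat =
  lang :: "('act, 'fl) signature"
  init_axs :: "('n, 'act, 'fl) fm set"
  poss_fm :: "'act \<Rightarrow> ('n, 'act, 'fl) fm"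
  ssa_fm :: "'fl \<Rightarrow> ('n, 'act, 'fl) fm"

definition wf_bat :: "('n, 'act, 'fl) bat \<Rightarrow> bool" where
  "wf_bat D \<longleftrightarrow>
     wf_signature (lang D) \<and>
     (\<forall>\<phi>\<in>init_axs D. wf_fm (lang D) {} {} \<phi>) \<and>
     (\<forall>A\<in>set (act_types (lang D)). wf_fm (lang D) {..<act_arity (lang D) A} {} (poss_fm D A)) \<and>
     (\<forall>F\<in>set (fluents (lang D)). wf_fm (lang D) {..<fl_arity (lang D) F} {0} (ssa_fm D F))"

section \<open>Structures\<close>

text \<open>
  The domains of the object, action and situation sorts are the types \<open>'o\<close>, \<open>'a\<close>, \<open>'s\<close>. The
  domain of the program sort consists of the closed program terms with parameters from \<open>'o\<close>.
\<close>

record ('n, 'act, 'fl, 'o, 'a, 's) struct =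
  con\<^sub>M :: "'n \<Rightarrow> 'o"
  act\<^sub>M :: "'act \<Rightarrow> 'o list \<Rightarrow> 'a"
  init\<^sub>M :: 's
  do\<^sub>M :: "'a \<Rightarrow> 's \<Rightarrow> 's"
  prec\<^sub>M :: "'s \<Rightarrow> 's \<Rightarrow> bool"
  poss\<^sub>M :: "'a \<Rightarrow> 's \<Rightarrow> bool"
  fl\<^sub>M :: "'fl \<Rightarrow> 'o list \<Rightarrow> 's \<Rightarrow> bool"
  trans\<^sub>M :: "('o, 'act, 'fl) prog \<Rightarrow> 's \<Rightarrow> ('o, 'act, 'fl) prog \<Rightarrow> 's \<Rightarrow> bool"
  final\<^sub>M :: "('o, 'act, 'fl) prog \<Rightarrow> 's \<Rightarrow> bool"

primrec val_oterm :: "(nat \<Rightarrow> 'o) \<Rightarrow> 'o oterm \<Rightarrow> 'o" where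
  "val_oterm v (OVar x) = v x"
| "val_oterm v (Const d) = d"

primrec val_aterm ::
  "('n, 'act, 'fl, 'o, 'a, 's) struct \<Rightarrow> (nat \<Rightarrow> 'o) \<Rightarrow> (nat \<Rightarrow> 'a) \<Rightarrow> ('o, 'act) aterm \<Rightarrow> 'a" where
  "val_aterm M v w (AVar a) = w a"
| "val_aterm M v w (Act A ts) = act\<^sub>M M A (map (val_oterm v) ts)"

primrec sat ::
  "('n, 'act, 'fl, 'o, 'a, 's) struct \<Rightarrow> (nat \<Rightarrow> 'o) \<Rightarrow> (nat \<Rightarrow> 'a) \<Rightarrow> 's
    \<Rightarrow> ('o, 'act, 'fl) fm \<Rightarrow> bool" where
  "sat M v w s Tru \<longleftrightarrow> True"
| "sat M v w s (Fluent F ts) \<longleftrightarrow> fl\<^sub>M M F (map (val_oterm v) ts) s"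
| "sat M v w s (EqO t u) \<longleftrightarrow> val_oterm v t = val_oterm v u"
| "sat M v w s (EqA t u) \<longleftrightarrow> val_aterm M v w t = val_aterm M v w u"
| "sat M v w s (Neg \<phi>) \<longleftrightarrow> \<not> sat M v w s \<phi>"
| "sat M v w s (Conj \<phi> \<psi>) \<longleftrightarrow> sat M v w s \<phi> \<and> sat M v w s \<psi>"
| "sat M v w s (ExO x \<phi>) \<longleftrightarrow> (\<exists>d. sat M (v(x := d)) w s \<phi>)"
| "sat M v w s (ExA a \<phi>) \<longleftrightarrow> (\<exists>e. sat M v (w(a := e)) s \<phi>)"

text \<open>Denotations: each standard name is replaced by the object it denotes.\<close>

definition den_fm ::
  "('n, 'act, 'fl, 'o, 'a, 's) struct \<Rightarrow> ('n, 'act, 'fl) fm \<Rightarrow> ('o, 'act, 'fl) fm" where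
  "den_fm M = map_fm (con\<^sub>M M) id id"

definition den_prog ::
  "('n, 'act, 'fl, 'o, 'a, 's) struct \<Rightarrow> ('n, 'act, 'fl) prog \<Rightarrow> ('o, 'act, 'fl) prog" where
  "den_prog M = map_prog (con\<^sub>M M) id id"

primrec den_sit :: "('n, 'act, 'fl, 'o, 'a, 's) struct \<Rightarrow> ('n, 'act) gsit \<Rightarrow> 's" where
  "den_sit M Init = init\<^sub>M M"
| "den_sit M (Do_act \<alpha> S) = do\<^sub>M M (act\<^sub>M M (fst \<alpha>) (map (con\<^sub>M M) (snd \<alpha>))) (den_sit M S)"

section \<open>Models\<close>

definition sat_foundational :: "('n, 'act, 'fl, 'o, 'a, 's) struct \<Rightarrow> bool" where
  "sat_foundational M \<longleftrightarrow>
     (\<forall>a s a' s'. do\<^sub>M M a s = do\<^sub>M M a' s' \<longrightarrow> a = a' \<and> s = s') \<and>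
     (\<forall>P. P (init\<^sub>M M) \<and> (\<forall>a s. P s \<longrightarrow> P (do\<^sub>M M a s)) \<longrightarrow> (\<forall>s. P s)) \<and>
     (\<forall>s. \<not> prec\<^sub>M M s (init\<^sub>M M)) \<and>
     (\<forall>a s s'. prec\<^sub>M M s (do\<^sub>M M a s') \<longleftrightarrow> prec\<^sub>M M s s' \<or> s = s')"

definition sat_coa :: "('n, 'act, 'fl, 'o, 'a, 's) struct \<Rightarrow> bool" where
  "sat_coa M \<longleftrightarrow>
     (\<forall>n n'. n \<noteq> n' \<longrightarrow> con\<^sub>M M n \<noteq> con\<^sub>M M n') \<and> (\<forall>d. \<exists>n. d = con\<^sub>M M n)"

definition sat_ca ::
  "('act, 'fl) signature \<Rightarrow> ('n, 'act, 'fl, 'o, 'a, 's) struct \<Rightarrow> bool" where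
  "sat_ca L M \<longleftrightarrow>
     (\<forall>(A, ds)\<in>ground_actions L. \<forall>(B, es)\<in>ground_actions L.
        act\<^sub>M M A ds = act\<^sub>M M B es \<longrightarrow> A = B \<and> ds = es) \<and>
     (\<forall>a. \<exists>(A, ds)\<in>ground_actions L. a = act\<^sub>M M A ds)"

definition sat_bat ::
  "('n, 'act, 'fl) bat \<Rightarrow> ('n, 'act, 'fl, 'o, 'a, 's) struct \<Rightarrow> bool" where
  "sat_bat D M \<longleftrightarrow>
     sat_foundational M \<and> sat_coa M \<and> sat_ca (lang D) M \<and>
     (\<forall>\<phi>\<in>init_axs D. \<forall>v w. sat M v w (init\<^sub>M M) (den_fm M \<phi>)) \<and>
     (\<forall>A\<in>set (act_types (lang D)). \<forall>v w s.
        poss\<^sub>M M (act\<^sub>M M A (map v [0..<act_arity (lang D) A])) s \<longleftrightarrow>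
        sat M v w s (den_fm M (poss_fm D A))) \<and>
     (\<forall>F\<in>set (fluents (lang D)). \<forall>v w s.
        fl\<^sub>M M F (map v [0..<fl_arity (lang D) F]) (do\<^sub>M M (w 0) s) \<longleftrightarrow>
        sat M v w s (den_fm M (ssa_fm D F)))"

text \<open>
  In the axioms for action choice, the quantifier over actions is a quantifier over the terms
  \<open>A(d\<^sub>1, \<dots>, d\<^sub>k)\<close>, which name each action exactly once by \<open>sat_ca\<close>. Assignments are irrelevant in
  the axioms for primitive actions and tests, since the programs are closed.
\<close>

definition sat_congolog ::
  "('act, 'fl) signature \<Rightarrow> ('n, 'act, 'fl, 'o, 'a, 's) struct \<Rightarrow> bool" where
  "sat_congolog L M \<longleftrightarrow>
     (\<forall>\<alpha> s \<delta>' s'. Prim \<alpha> \<in> closed_progs L \<longrightarrow> (\<forall>v w.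
        trans\<^sub>M M (Prim \<alpha>) s \<delta>' s' \<longleftrightarrow>
          s' = do\<^sub>M M (val_aterm M v w \<alpha>) s \<and> poss\<^sub>M M (val_aterm M v w \<alpha>) s \<and> \<delta>' = nil)) \<and>
     (\<forall>\<phi> s \<delta>' s'. Test \<phi> \<in> closed_progs L \<longrightarrow> \<not> trans\<^sub>M M (Test \<phi>) s \<delta>' s') \<and>
     (\<forall>\<delta>\<^sub>1 \<delta>\<^sub>2 s \<delta>' s'. Seq \<delta>\<^sub>1 \<delta>\<^sub>2 \<in> closed_progs L \<longrightarrow>
        (trans\<^sub>M M (Seq \<delta>\<^sub>1 \<delta>\<^sub>2) s \<delta>' s' \<longleftrightarrow>
          (\<exists>\<delta>\<^sub>1'. trans\<^sub>M M \<delta>\<^sub>1 s \<delta>\<^sub>1' s' \<and> \<delta>' = Seq \<delta>\<^sub>1' \<delta>\<^sub>2) \<or>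
          (final\<^sub>M M \<delta>\<^sub>1 s \<and> trans\<^sub>M M \<delta>\<^sub>2 s \<delta>' s'))) \<and>
     (\<forall>\<delta>\<^sub>1 \<delta>\<^sub>2 s \<delta>' s'. Choice \<delta>\<^sub>1 \<delta>\<^sub>2 \<in> closed_progs L \<longrightarrow>
        (trans\<^sub>M M (Choice \<delta>\<^sub>1 \<delta>\<^sub>2) s \<delta>' s' \<longleftrightarrow>
          trans\<^sub>M M \<delta>\<^sub>1 s \<delta>' s' \<or> trans\<^sub>M M \<delta>\<^sub>2 s \<delta>' s')) \<and>
     (\<forall>x \<delta> s \<delta>' s'. PiO x \<delta> \<in> closed_progs L \<longrightarrow>
        (trans\<^sub>M M (PiO x \<delta>) s \<delta>' s' \<longleftrightarrow>
          (\<exists>d. trans\<^sub>M M (subst_prog [x \<mapsto> d] Map.empty \<delta>) s \<delta>' s'))) \<and>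
     (\<forall>a \<delta> s \<delta>' s'. PiA a \<delta> \<in> closed_progs L \<longrightarrow>
        (trans\<^sub>M M (PiA a \<delta>) s \<delta>' s' \<longleftrightarrow>
          (\<exists>\<beta>\<in>ground_actions L. trans\<^sub>M M (subst_prog Map.empty [a \<mapsto> \<beta>] \<delta>) s \<delta>' s'))) \<and>
     (\<forall>\<delta> s \<delta>' s'. Star \<delta> \<in> closed_progs L \<longrightarrow>
        (trans\<^sub>M M (Star \<delta>) s \<delta>' s' \<longleftrightarrow>
          (\<exists>\<delta>''. trans\<^sub>M M \<delta> s \<delta>'' s' \<and> \<delta>' = Seq \<delta>'' (Star \<delta>)))) \<and>
     (\<forall>\<delta>\<^sub>1 \<delta>\<^sub>2 s \<delta>' s'. Conc \<delta>\<^sub>1 \<delta>\<^sub>2 \<in> closed_progs L \<longrightarrow>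
        (trans\<^sub>M M (Conc \<delta>\<^sub>1 \<delta>\<^sub>2) s \<delta>' s' \<longleftrightarrow>
          (\<exists>\<delta>\<^sub>1'. trans\<^sub>M M \<delta>\<^sub>1 s \<delta>\<^sub>1' s' \<and> \<delta>' = Conc \<delta>\<^sub>1' \<delta>\<^sub>2) \<or>
          (\<exists>\<delta>\<^sub>2'. trans\<^sub>M M \<delta>\<^sub>2 s \<delta>\<^sub>2' s' \<and> \<delta>' = Conc \<delta>\<^sub>1 \<delta>\<^sub>2'))) \<and>
     (\<forall>\<alpha> s. Prim \<alpha> \<in> closed_progs L \<longrightarrow> \<not> final\<^sub>M M (Prim \<alpha>) s) \<and>
     (\<forall>\<phi> s. Test \<phi> \<in> closed_progs L \<longrightarrow>
        (\<forall>v w. final\<^sub>M M (Test \<phi>) s \<longleftrightarrow> sat M v w s \<phi>)) \<and>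
     (\<forall>\<delta>\<^sub>1 \<delta>\<^sub>2 s. Seq \<delta>\<^sub>1 \<delta>\<^sub>2 \<in> closed_progs L \<longrightarrow>
        (final\<^sub>M M (Seq \<delta>\<^sub>1 \<delta>\<^sub>2) s \<longleftrightarrow> final\<^sub>M M \<delta>\<^sub>1 s \<and> final\<^sub>M M \<delta>\<^sub>2 s)) \<and>
     (\<forall>\<delta>\<^sub>1 \<delta>\<^sub>2 s. Choice \<delta>\<^sub>1 \<delta>\<^sub>2 \<in> closed_progs L \<longrightarrow>
        (final\<^sub>M M (Choice \<delta>\<^sub>1 \<delta>\<^sub>2) s \<longleftrightarrow> final\<^sub>M M \<delta>\<^sub>1 s \<or> final\<^sub>M M \<delta>\<^sub>2 s)) \<and>
     (\<forall>x \<delta> s. PiO x \<delta> \<in> closed_progs L \<longrightarrow>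
        (final\<^sub>M M (PiO x \<delta>) s \<longleftrightarrow>
          (\<exists>d. final\<^sub>M M (subst_prog [x \<mapsto> d] Map.empty \<delta>) s))) \<and>
     (\<forall>a \<delta> s. PiA a \<delta> \<in> closed_progs L \<longrightarrow>
        (final\<^sub>M M (PiA a \<delta>) s \<longleftrightarrow>
          (\<exists>\<beta>\<in>ground_actions L. final\<^sub>M M (subst_prog Map.empty [a \<mapsto> \<beta>] \<delta>) s))) \<and>
     (\<forall>\<delta> s. Star \<delta> \<in> closed_progs L \<longrightarrow> final\<^sub>M M (Star \<delta>) s) \<and>
     (\<forall>\<delta>\<^sub>1 \<delta>\<^sub>2 s. Conc \<delta>\<^sub>1 \<delta>\<^sub>2 \<in> closed_progs L \<longrightarrow>
        (final\<^sub>M M (Conc \<delta>\<^sub>1 \<delta>\<^sub>2) s \<longleftrightarrow> final\<^sub>M M \<delta>\<^sub>1 s \<and> final\<^sub>M M \<delta>\<^sub>2 s))"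

definition model_with_congolog ::
  "('n, 'act, 'fl) bat \<Rightarrow> ('n, 'act, 'fl, 'o, 'a, 's) struct \<Rightarrow> bool" where
  "model_with_congolog D M \<longleftrightarrow> sat_bat D M \<and> sat_congolog (lang D) M"

text \<open>
  \<open>D \<union> C \<Turnstile> \<Phi>\<close>, a sentence being given by its truth value in each structure. HOL cannot quantify over
  the domain types, so the structures range over those with the domain types of \<open>\<Phi>\<close>. If there is a
  model with these domains at all, this is no restriction: the axioms for names, actions and situations
  determine the three domains up to isomorphism.
\<close>

definition entails_with_congolog ::
  "('n, 'act, 'fl) bat \<Rightarrow> (('n, 'act, 'fl, 'o, 'a, 's) struct \<Rightarrow> bool) \<Rightarrow> bool" where
  "entails_with_congolog D \<Phi> \<longleftrightarrow> (\<forall>M. model_with_congolog D M \<longrightarrow> \<Phi> M)"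

section \<open>Derived notions\<close>

definition trans_star ::
  "('n, 'act, 'fl, 'o, 'a, 's) struct
    \<Rightarrow> ('o, 'act, 'fl) prog \<Rightarrow> 's \<Rightarrow> ('o, 'act, 'fl) prog \<Rightarrow> 's \<Rightarrow> bool" where
  "trans_star M \<delta> s \<delta>' s' \<longleftrightarrow>
     (\<lambda>(\<delta>\<^sub>1, s\<^sub>1) (\<delta>\<^sub>2, s\<^sub>2). trans\<^sub>M M \<delta>\<^sub>1 s\<^sub>1 \<delta>\<^sub>2 s\<^sub>2)\<^sup>*\<^sup>* (\<delta>, s) (\<delta>', s')"

definition Do ::
  "('n, 'act, 'fl, 'o, 'a, 's) struct \<Rightarrow> ('o, 'act, 'fl) prog \<Rightarrow> 's \<Rightarrow> 's \<Rightarrow> bool" where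
  "Do M \<delta> s s' \<longleftrightarrow> (\<exists>\<delta>'. trans_star M \<delta> s \<delta>' s' \<and> final\<^sub>M M \<delta>' s')"

definition situation_determined ::
  "('n, 'act, 'fl, 'o, 'a, 's) struct \<Rightarrow> ('o, 'act, 'fl) prog \<Rightarrow> 's \<Rightarrow> bool" where
  "situation_determined M \<delta> s \<longleftrightarrow>
     (\<forall>s' \<delta>' \<delta>''. trans_star M \<delta> s \<delta>' s' \<and> trans_star M \<delta> s \<delta>'' s' \<longrightarrow> \<delta>' = \<delta>'')"

definition exec_less :: "('n, 'act, 'fl, 'o, 'a, 's) struct \<Rightarrow> 's \<Rightarrow> 's \<Rightarrow> bool" where
  "exec_less M = (\<lambda>s s'. \<exists>a. poss\<^sub>M M a s \<and> s' = do\<^sub>M M a s)\<^sup>+\<^sup>+"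

section \<open>Refinement mappings\<close>

record ('n, 'ah, 'fh, 'al, 'fl) mapping =
  m_act :: "'ah \<Rightarrow> ('n, 'al, 'fl) prog"
  m_fl :: "'fh \<Rightarrow> ('n, 'al, 'fl) fm"

text \<open>
  The first argument only fixes the domain types over which situation-determinedness of the mapped
  programs is entailed by the low-level theory. The high- and low-level action types and fluents
  have different types, hence no symbols in common.
\<close>

definition refinement_mapping ::
  "('n, 'al, 'fl, 'o, 'a, 's) struct itself \<Rightarrow> ('n, 'ah, 'fh) bat \<Rightarrow> ('n, 'al, 'fl) bat
    \<Rightarrow> ('n, 'ah, 'fh, 'al, 'fl) mapping \<Rightarrow> bool" where
  "refinement_mapping T D\<^sub>h D\<^sub>l m \<longleftrightarrow>
     (\<forall>A\<in>set (act_types (lang D\<^sub>h)).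
        wf_prog (lang D\<^sub>l) {..<act_arity (lang D\<^sub>h) A} {} (m_act m A) \<and>
        entails_with_congolog D\<^sub>l (\<lambda>M :: ('n, 'al, 'fl, 'o, 'a, 's) struct.
          \<forall>ds s. length ds = act_arity (lang D\<^sub>h) A \<longrightarrow>
            situation_determined M (inst_prog ds (den_prog M (m_act m A))) s)) \<and>
     (\<forall>F\<in>set (fluents (lang D\<^sub>h)).
        wf_fm (lang D\<^sub>l) {..<fl_arity (lang D\<^sub>h) F} {} (m_fl m F))"

definition map_action ::
  "('n, 'ah, 'fh, 'al, 'fl) mapping \<Rightarrow> ('n, 'ah) gaction \<Rightarrow> ('n, 'al, 'fl) prog" where
  "map_action m \<alpha> = inst_prog (snd \<alpha>) (m_act m (fst \<alpha>))"

definition map_actions ::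
  "('n, 'ah, 'fh, 'al, 'fl) mapping \<Rightarrow> ('n, 'ah) gaction list \<Rightarrow> ('n, 'al, 'fl) prog" where
  "map_actions m \<alpha>s = seqs (map (map_action m) \<alpha>s)"

definition any1hl ::
  "('ah, 'fh) signature \<Rightarrow> ('n, 'ah, 'fh, 'al, 'fl) mapping \<Rightarrow> ('n, 'al, 'fl) prog" where
  "any1hl L m = choices (map (\<lambda>A. pis (act_arity L A) (m_act m A)) (act_types L))"

definition anyseqhl ::
  "('ah, 'fh) signature \<Rightarrow> ('n, 'ah, 'fh, 'al, 'fl) mapping \<Rightarrow> ('n, 'al, 'fl) prog" where
  "anyseqhl L m = Star (any1hl L m)"

end

theory Submission
  imports Defs
begin

text \<open>
  Every transition performs exactly one action, so a run ending in \<open>s'\<close> passes through all the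
  situations between its start and \<open>s'\<close>. Two decompositions of the same run into implementations
  of high-level actions finish their first action at comparable situations, say \<open>s\<^sub>1 \<sqsubseteq> s\<^sub>2\<close>; the second
  implementation then passes through \<open>s\<^sub>1\<close>, so (a) makes both actions equal and (b) gives \<open>s\<^sub>1 = s\<^sub>2\<close>.
  Condition (c) excludes that one decomposition is a proper prefix of the other. For existence, a
  terminating run of the iteration splits into runs of its body, each of which selects a high-level
  action type and, by domain closure, standard names as its arguments.
\<close>

section \<open>Substitution\<close>

text \<open>In \<open>++\<close> the right operand takes precedence, as composition requires: the
  substitution applied first wins, and the outer one only reaches variables still left. Only ground
  terms are inserted, so nothing inserted is substituted again.\<close>

lemma subst_oterm_comp: "subst_oterm \<sigma>' (subst_oterm \<sigma> t) = subst_oterm (\<sigma>' ++ \<sigma>) t"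
  by (cases t) (auto simp: map_add_def split: option.splits)

lemma subst_aterm_comp:
  "subst_aterm \<sigma>' \<tau>' (subst_aterm \<sigma> \<tau> t) = subst_aterm (\<sigma>' ++ \<sigma>) (\<tau>' ++ \<tau>) t"
  by (cases t) (auto simp: subst_oterm_comp map_add_def split: option.splits)

lemma map_add_upd_None: "f(x := None) ++ g(x := None) = (f ++ g)(x := None)"
  by (auto simp: map_add_def fun_eq_iff split: option.split)

lemma subst_fm_comp:
  "subst_fm \<sigma>' \<tau>' (subst_fm \<sigma> \<tau> \<phi>) = subst_fm (\<sigma>' ++ \<sigma>) (\<tau>' ++ \<tau>) \<phi>"
  by (induction \<phi> arbitrary: \<sigma> \<sigma>' \<tau> \<tau>')
    (simp_all add: subst_oterm_comp subst_aterm_comp map_add_upd_None)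

lemma subst_prog_comp:
  "subst_prog \<sigma>' \<tau>' (subst_prog \<sigma> \<tau> \<delta>) = subst_prog (\<sigma>' ++ \<sigma>) (\<tau>' ++ \<tau>) \<delta>"
  by (induction \<delta> arbitrary: \<sigma> \<sigma>' \<tau> \<tau>')
    (simp_all add: subst_fm_comp subst_aterm_comp map_add_upd_None)

lemma subst_oterm_empty: "subst_oterm Map.empty t = t"
  by (cases t) auto

lemma subst_aterm_empty: "subst_aterm Map.empty Map.empty t = t"
  by (cases t) (auto simp: subst_oterm_empty map_idI)

lemma subst_fm_empty: "subst_fm Map.empty Map.empty \<phi> = \<phi>"
  by (induction \<phi>) (simp_all add: subst_oterm_empty subst_aterm_empty map_idI)

lemma subst_prog_empty: "subst_prog Map.empty Map.empty \<delta> = \<delta>"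
  by (induction \<delta>) (simp_all add: subst_fm_empty subst_aterm_empty)

lemma wf_oterm_subst: "wf_oterm X t \<Longrightarrow> wf_oterm (X - dom \<sigma>) (subst_oterm \<sigma> t)"
  by (cases t) (auto split: option.splits)

text \<open>The bound on \<open>ran \<tau>\<close> keeps inserted actions within the signature:
  without it they could have a foreign type or a wrong number of arguments.\<close>

lemma wf_aterm_subst:
  assumes "wf_aterm L X Y t" "ran \<tau> \<subseteq> ground_actions L"
  shows "wf_aterm L (X - dom \<sigma>) (Y - dom \<tau>) (subst_aterm \<sigma> \<tau> t)"
  using assms
  by (cases t) (force simp: wf_oterm_subst ground_actions_def ran_def split: option.splits)+

text \<open>For the binder cases: a bound variable is shielded from the substitution, so it stays
  allowed in the body even if the outer map assigns it a constant.\<close>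

lemma insert_Diff_dom_upd_None: "insert x X - dom (\<sigma>(x := None)) = insert x (X - dom \<sigma>)"
  by auto

lemma ran_upd_None_subset: "ran \<tau> \<subseteq> G \<Longrightarrow> ran (\<tau>(x := None)) \<subseteq> G"
  by (auto simp: ran_def split: if_splits)

lemma wf_fm_subst:
  assumes "wf_fm L X Y \<phi>" "ran \<tau> \<subseteq> ground_actions L"
  shows "wf_fm L (X - dom \<sigma>) (Y - dom \<tau>) (subst_fm \<sigma> \<tau> \<phi>)"
  using assms
proof (induction \<phi> arbitrary: X Y \<sigma> \<tau>)
  case (ExO x \<phi>)
  then show ?case
    using ExO.IH[of "insert x X" Y \<tau> "\<sigma>(x := None)"]
    by (simp only: insert_Diff_dom_upd_None wf_fm.simps subst_fm.simps)
next
  case (ExA x \<phi>)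
  then show ?case
    using ExA.IH[of X "insert x Y" "\<tau>(x := None)" \<sigma>]
    by (simp only: insert_Diff_dom_upd_None wf_fm.simps subst_fm.simps ran_upd_None_subset)
qed (auto simp: wf_oterm_subst wf_aterm_subst)

lemma wf_prog_subst:
  assumes "wf_prog L X Y \<delta>" "ran \<tau> \<subseteq> ground_actions L"
  shows "wf_prog L (X - dom \<sigma>) (Y - dom \<tau>) (subst_prog \<sigma> \<tau> \<delta>)"
  using assms
proof (induction \<delta> arbitrary: X Y \<sigma> \<tau>)
  case (PiO x \<delta>)
  then show ?case
    using PiO.IH[of "insert x X" Y \<tau> "\<sigma>(x := None)"]
    by (simp only: insert_Diff_dom_upd_None wf_prog.simps subst_prog.simps)
next
  case (PiA x \<delta>)
  then show ?case
    using PiA.IH[of X "insert x Y" "\<tau>(x := None)" \<sigma>]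
    by (simp only: insert_Diff_dom_upd_None wf_prog.simps subst_prog.simps ran_upd_None_subset)
qed (auto simp: wf_fm_subst wf_aterm_subst)

lemma closed_subst_PiO:
  "PiO x \<delta> \<in> closed_progs L \<Longrightarrow> subst_prog [x \<mapsto> d] Map.empty \<delta> \<in> closed_progs L"
  using wf_prog_subst[of L "{x}" "{}" \<delta> Map.empty "[x \<mapsto> d]"] by (simp add: closed_progs_def)

lemma closed_subst_PiA:
  "PiA x \<delta> \<in> closed_progs L \<Longrightarrow> \<beta> \<in> ground_actions L \<Longrightarrow>
    subst_prog Map.empty [x \<mapsto> \<beta>] \<delta> \<in> closed_progs L"
  using wf_prog_subst[of L "{}" "{x}" \<delta> "[x \<mapsto> \<beta>]" Map.empty] by (simp add: closed_progs_def)

lemma closed_inst_prog: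
  assumes "wf_prog L {..<length cs} {} \<delta>"
  shows "inst_prog cs \<delta> \<in> closed_progs L"
proof -
  have "dom (\<lambda>x. if x < length cs then Some (cs ! x) else None) = {..<length cs}"
    by (auto split: if_splits)
  then show ?thesis
    using wf_prog_subst[OF assms, of Map.empty "\<lambda>x. if x < length cs then Some (cs ! x) else None"]
    by (simp add: closed_progs_def inst_prog_def)
qed

lemma wf_prog_foldr_PiO: "wf_prog L X Y (foldr PiO xs \<delta>) \<longleftrightarrow> wf_prog L (X \<union> set xs) Y \<delta>"
  by (induction xs arbitrary: X) auto

lemma wf_prog_choices: "(\<And>\<delta>. \<delta> \<in> set \<delta>s \<Longrightarrow> wf_prog L X Y \<delta>) \<Longrightarrow> wf_prog L X Y (choices \<delta>s)"
  by (induction \<delta>s rule: choices.induct) auto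

lemma wf_prog_seqs: "(\<And>\<delta>. \<delta> \<in> set \<delta>s \<Longrightarrow> wf_prog L X Y \<delta>) \<Longrightarrow> wf_prog L X Y (seqs \<delta>s)"
  by (induction \<delta>s rule: seqs.induct) auto

section \<open>Renaming of constants\<close>

lemma wf_oterm_map: "wf_oterm X (map_oterm f t) \<longleftrightarrow> wf_oterm X t"
  by (cases t) auto

lemma wf_aterm_map: "wf_aterm L X Y (map_aterm f id t) \<longleftrightarrow> wf_aterm L X Y t"
  by (cases t) (auto simp: wf_oterm_map)

lemma wf_fm_map: "wf_fm L X Y (map_fm f id id \<phi>) \<longleftrightarrow> wf_fm L X Y \<phi>"
  by (induction \<phi> arbitrary: X Y) (auto simp: wf_oterm_map wf_aterm_map)

lemma wf_prog_map: "wf_prog L X Y (map_prog f id id \<delta>) \<longleftrightarrow> wf_prog L X Y \<delta>"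
  by (induction \<delta> arbitrary: X Y) (auto simp: wf_fm_map wf_aterm_map)

lemma map_subst_oterm:
  "map_oterm f (subst_oterm \<sigma> t) = subst_oterm (map_option f \<circ> \<sigma>) (map_oterm f t)"
  by (cases t) (auto split: option.splits)

lemma map_subst_aterm:
  "map_aterm f id (subst_aterm \<sigma> Map.empty t) =
    subst_aterm (map_option f \<circ> \<sigma>) Map.empty (map_aterm f id t)"
  by (cases t) (auto simp: map_subst_oterm)

lemma map_option_comp_upd_None: "map_option f \<circ> \<sigma>(x := None) = (map_option f \<circ> \<sigma>)(x := None)"
  by auto

lemma map_subst_fm:
  "map_fm f id id (subst_fm \<sigma> Map.empty \<phi>) =
    subst_fm (map_option f \<circ> \<sigma>) Map.empty (map_fm f id id \<phi>)"
  by (induction \<phi> arbitrary: \<sigma>)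
    (simp_all add: map_subst_oterm map_subst_aterm map_option_comp_upd_None del: fun_upd_apply)

lemma map_subst_prog:
  "map_prog f id id (subst_prog \<sigma> Map.empty \<delta>) =
    subst_prog (map_option f \<circ> \<sigma>) Map.empty (map_prog f id id \<delta>)"
  by (induction \<delta> arbitrary: \<sigma>)
    (simp_all add: map_subst_fm map_subst_aterm map_option_comp_upd_None)

text \<open>Bridges mapped actions, whose arguments are standard names, and the programs that occur
  in runs, whose parameters are objects of the structure.\<close>

lemma map_inst_prog:
  "map_prog f id id (inst_prog cs \<delta>) = inst_prog (map f cs) (map_prog f id id \<delta>)"
proof -
  have "map_option f \<circ> (\<lambda>x. if x < length cs then Some (cs ! x) else None) =
      (\<lambda>x. if x < length (map f cs) then Some (map f cs ! x) else None)"
    by (auto simp: fun_eq_iff)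
  then show ?thesis
    by (simp only: inst_prog_def map_subst_prog)
qed

lemma map_foldr_PiO: "map_prog f g h (foldr PiO xs \<delta>) = foldr PiO xs (map_prog f g h \<delta>)"
  by (induction xs) auto

lemma map_choices: "map_prog f g h (choices \<delta>s) = choices (map (map_prog f g h) \<delta>s)"
  by (induction \<delta>s rule: choices.induct) auto

lemma map_seqs: "map_prog f g h (seqs \<delta>s) = seqs (map (map_prog f g h) \<delta>s)"
  by (induction \<delta>s rule: seqs.induct) auto

section \<open>Histories\<close>

locale situation_history =
  fixes M :: "('n, 'act, 'fl, 'o, 'a, 's) struct"
  assumes foundational: "sat_foundational M"
begin

text \<open>Whether the action is possible is ignored here: only the tree shape of histories matters
  for locating situations along a run. \<open>exec_less\<close> embeds into the transitive
  closure.\<close>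

definition succ :: "'s \<Rightarrow> 's \<Rightarrow> bool" where
  "succ s s' \<longleftrightarrow> (\<exists>a. s' = do\<^sub>M M a s)"

lemma do_inject: "do\<^sub>M M a s = do\<^sub>M M a' s' \<Longrightarrow> a = a' \<and> s = s'"
  using foundational unfolding sat_foundational_def by (elim conjE) simp

lemma sit_induct: "P (init\<^sub>M M) \<Longrightarrow> (\<And>a s. P s \<Longrightarrow> P (do\<^sub>M M a s)) \<Longrightarrow> P s"
  using foundational unfolding sat_foundational_def by (elim conjE) metis

lemma not_prec_init: "\<not> prec\<^sub>M M s (init\<^sub>M M)"
  using foundational by (simp only: sat_foundational_def not_False_eq_True)

lemma prec_do: "prec\<^sub>M M s (do\<^sub>M M a s') \<longleftrightarrow> prec\<^sub>M M s s' \<or> s = s'"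
  using foundational by (simp only: sat_foundational_def)

lemma prec_do_left: "prec\<^sub>M M (do\<^sub>M M a s) s' \<Longrightarrow> prec\<^sub>M M s s'"
  by (induction s' rule: sit_induct) (auto simp: not_prec_init prec_do)

text \<open>If the successor of \<open>s\<close> preceded itself, it would precede or equal
  \<open>s\<close>; as \<open>s\<close> precedes its successor, either case puts \<open>s\<close>
  before itself.\<close>

lemma prec_irrefl: "\<not> prec\<^sub>M M s s"
proof (induction s rule: sit_induct)
  case (2 a s)
  then show ?case
    using prec_do_left prec_do by metis
qed (rule not_prec_init)

lemma succ_tranclp_prec: "succ\<^sup>+\<^sup>+ s s' \<Longrightarrow> prec\<^sub>M M s s'"
  by (induction rule: tranclp_induct) (auto simp: succ_def prec_do)

lemma succ_acyclic: "\<not> succ\<^sup>+\<^sup>+ s s"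
  using succ_tranclp_prec prec_irrefl by blast

lemma succ_antisym: "succ\<^sup>*\<^sup>* s s' \<Longrightarrow> succ\<^sup>*\<^sup>* s' s \<Longrightarrow> s = s'"
  using succ_acyclic by (metis rtranclpD tranclp_trans)

lemma exec_less_succ: "exec_less M s s' \<Longrightarrow> succ\<^sup>+\<^sup>+ s s'"
  unfolding exec_less_def
  by (induction rule: tranclp_induct) (metis succ_def tranclp.simps)+

text \<open>By injectivity of \<open>do\<^sub>M\<close>, a non-initial situation has only one
  predecessor, so every nonempty path to it comes through that predecessor.\<close>

lemma succ_rtranclp_do_cases: "succ\<^sup>*\<^sup>* s (do\<^sub>M M a s') \<Longrightarrow> s = do\<^sub>M M a s' \<or> succ\<^sup>*\<^sup>* s s'"
  by (erule rtranclp.cases) (auto simp: succ_def dest: do_inject)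

text \<open>Unique predecessors make the ancestors of a situation a chain. The endpoints of two
  first actions can thus be compared, since both are ancestors of the common end.\<close>

lemma succ_linear:
  assumes "succ\<^sup>*\<^sup>* s\<^sub>1 e" "succ\<^sup>*\<^sup>* s\<^sub>2 e"
  shows "succ\<^sup>*\<^sup>* s\<^sub>1 s\<^sub>2 \<or> succ\<^sup>*\<^sup>* s\<^sub>2 s\<^sub>1"
  using assms
proof (induction rule: rtranclp_induct)
  case (step s s')
  obtain a where "s' = do\<^sub>M M a s"
    using step.hyps by (auto simp: succ_def)
  with step.prems succ_rtranclp_do_cases have "s\<^sub>2 = s' \<or> succ\<^sup>*\<^sup>* s\<^sub>2 s"
    by blast
  then show ?case
    using step by (meson rtranclp.rtrancl_into_rtrancl)
qed auto

end

section \<open>Program execution\<close>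

locale congolog_model = situation_history M
  for M :: "('n, 'act, 'fl, 'o, 'a, 's) struct" +
  fixes L :: "('act, 'fl) signature"
  assumes congolog: "sat_congolog L M"
begin

abbreviation closed :: "('o, 'act, 'fl) prog \<Rightarrow> bool" where
  "closed \<delta> \<equiv> \<delta> \<in> closed_progs L"

section \<open>Transition and termination clauses for closed programs\<close>

lemma trans_Prim:
  "closed (Prim \<alpha>) \<Longrightarrow> trans\<^sub>M M (Prim \<alpha>) s \<delta>' s' \<longleftrightarrow>
    s' = do\<^sub>M M (val_aterm M v w \<alpha>) s \<and> poss\<^sub>M M (val_aterm M v w \<alpha>) s \<and> \<delta>' = nil"
  using congolog unfolding sat_congolog_def by (elim conjE) blast

lemma trans_Test: "closed (Test \<phi>) \<Longrightarrow> \<not> trans\<^sub>M M (Test \<phi>) s \<delta>' s'"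
  using congolog unfolding sat_congolog_def by (elim conjE) blast

lemma trans_Seq:
  "closed (Seq \<delta>\<^sub>1 \<delta>\<^sub>2) \<Longrightarrow> trans\<^sub>M M (Seq \<delta>\<^sub>1 \<delta>\<^sub>2) s \<delta>' s' \<longleftrightarrow>
    (\<exists>\<delta>\<^sub>1'. trans\<^sub>M M \<delta>\<^sub>1 s \<delta>\<^sub>1' s' \<and> \<delta>' = Seq \<delta>\<^sub>1' \<delta>\<^sub>2) \<or> final\<^sub>M M \<delta>\<^sub>1 s \<and> trans\<^sub>M M \<delta>\<^sub>2 s \<delta>' s'"
  using congolog by (simp only: sat_congolog_def)

lemma trans_Choice:
  "closed (Choice \<delta>\<^sub>1 \<delta>\<^sub>2) \<Longrightarrow> trans\<^sub>M M (Choice \<delta>\<^sub>1 \<delta>\<^sub>2) s \<delta>' s' \<longleftrightarrow>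
    trans\<^sub>M M \<delta>\<^sub>1 s \<delta>' s' \<or> trans\<^sub>M M \<delta>\<^sub>2 s \<delta>' s'"
  using congolog by (simp only: sat_congolog_def)

lemma trans_PiO:
  "closed (PiO x \<delta>) \<Longrightarrow> trans\<^sub>M M (PiO x \<delta>) s \<delta>' s' \<longleftrightarrow>
    (\<exists>d. trans\<^sub>M M (subst_prog [x \<mapsto> d] Map.empty \<delta>) s \<delta>' s')"
  using congolog by (simp only: sat_congolog_def)

lemma trans_PiA:
  "closed (PiA x \<delta>) \<Longrightarrow> trans\<^sub>M M (PiA x \<delta>) s \<delta>' s' \<longleftrightarrow>
    (\<exists>\<beta>\<in>ground_actions L. trans\<^sub>M M (subst_prog Map.empty [x \<mapsto> \<beta>] \<delta>) s \<delta>' s')"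
  using congolog by (simp only: sat_congolog_def)

lemma trans_Star:
  "closed (Star \<delta>) \<Longrightarrow> trans\<^sub>M M (Star \<delta>) s \<delta>' s' \<longleftrightarrow>
    (\<exists>\<delta>''. trans\<^sub>M M \<delta> s \<delta>'' s' \<and> \<delta>' = Seq \<delta>'' (Star \<delta>))"
  using congolog by (simp only: sat_congolog_def)

lemma trans_Conc:
  "closed (Conc \<delta>\<^sub>1 \<delta>\<^sub>2) \<Longrightarrow> trans\<^sub>M M (Conc \<delta>\<^sub>1 \<delta>\<^sub>2) s \<delta>' s' \<longleftrightarrow>
    (\<exists>\<delta>\<^sub>1'. trans\<^sub>M M \<delta>\<^sub>1 s \<delta>\<^sub>1' s' \<and> \<delta>' = Conc \<delta>\<^sub>1' \<delta>\<^sub>2) \<or>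
    (\<exists>\<delta>\<^sub>2'. trans\<^sub>M M \<delta>\<^sub>2 s \<delta>\<^sub>2' s' \<and> \<delta>' = Conc \<delta>\<^sub>1 \<delta>\<^sub>2')"
  using congolog by (simp only: sat_congolog_def)

lemma final_Test: "closed (Test \<phi>) \<Longrightarrow> final\<^sub>M M (Test \<phi>) s \<longleftrightarrow> sat M v w s \<phi>"
  using congolog by (simp only: sat_congolog_def)

lemma final_Seq:
  "closed (Seq \<delta>\<^sub>1 \<delta>\<^sub>2) \<Longrightarrow> final\<^sub>M M (Seq \<delta>\<^sub>1 \<delta>\<^sub>2) s \<longleftrightarrow> final\<^sub>M M \<delta>\<^sub>1 s \<and> final\<^sub>M M \<delta>\<^sub>2 s"
  using congolog by (simp only: sat_congolog_def)

lemma final_Choice: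
  "closed (Choice \<delta>\<^sub>1 \<delta>\<^sub>2) \<Longrightarrow>
    final\<^sub>M M (Choice \<delta>\<^sub>1 \<delta>\<^sub>2) s \<longleftrightarrow> final\<^sub>M M \<delta>\<^sub>1 s \<or> final\<^sub>M M \<delta>\<^sub>2 s"
  using congolog by (simp only: sat_congolog_def)

lemma final_PiO:
  "closed (PiO x \<delta>) \<Longrightarrow>
    final\<^sub>M M (PiO x \<delta>) s \<longleftrightarrow> (\<exists>d. final\<^sub>M M (subst_prog [x \<mapsto> d] Map.empty \<delta>) s)"
  using congolog by (simp only: sat_congolog_def)

lemma closed_simps [simp]:
  "closed nil"
  "closed (Test \<phi>) \<longleftrightarrow> wf_fm L {} {} \<phi>"
  "closed (Seq \<delta>\<^sub>1 \<delta>\<^sub>2) \<longleftrightarrow> closed \<delta>\<^sub>1 \<and> closed \<delta>\<^sub>2"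
  "closed (Choice \<delta>\<^sub>1 \<delta>\<^sub>2) \<longleftrightarrow> closed \<delta>\<^sub>1 \<and> closed \<delta>\<^sub>2"
  "closed (Star \<delta>) \<longleftrightarrow> closed \<delta>"
  "closed (Conc \<delta>\<^sub>1 \<delta>\<^sub>2) \<longleftrightarrow> closed \<delta>\<^sub>1 \<and> closed \<delta>\<^sub>2"
  by (auto simp: closed_progs_def)

text \<open>
  Transitions of \<open>PiO\<close> and \<open>PiA\<close> are those of instances of the body, so structural induction needs
  the claim for all substitution instances.
\<close>

lemma trans_subst_closed_succ:
  "trans\<^sub>M M (subst_prog \<sigma> \<tau> \<delta>) s \<delta>' s' \<Longrightarrow> closed (subst_prog \<sigma> \<tau> \<delta>) \<Longrightarrow>
    closed \<delta>' \<and> succ s s'"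
proof (induction \<delta> arbitrary: \<sigma> \<tau> s \<delta>' s')
  case (Prim \<alpha>)
  then show ?case
    \<comment> \<open>The axiom holds under every assignment, and the action term is closed, so
      arbitrary assignments will do.\<close>
    using trans_Prim[where v = undefined and w = undefined] by (auto simp: succ_def)
next
  case (Test \<phi>)
  then show ?case
    using trans_Test by (metis subst_prog.simps(2))
next
  case (Seq \<delta>\<^sub>1 \<delta>\<^sub>2)
  from Seq.prems have "closed (subst_prog \<sigma> \<tau> \<delta>\<^sub>1)" "closed (subst_prog \<sigma> \<tau> \<delta>\<^sub>2)"
    by simp_all
  with Seq.prems Seq.IH show ?case
    by (fastforce simp: trans_Seq)
next
  case (Choice \<delta>\<^sub>1 \<delta>\<^sub>2)
  from Choice.prems have "closed (subst_prog \<sigma> \<tau> \<delta>\<^sub>1)" "closed (subst_prog \<sigma> \<tau> \<delta>\<^sub>2)"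
    by simp_all
  with Choice.prems Choice.IH show ?case
    by (fastforce simp: trans_Choice)
next
  case (PiO x \<delta>)
  from PiO.prems have cl: "closed (PiO x (subst_prog (\<sigma>(x := None)) \<tau> \<delta>))"
    by simp
  with PiO.prems(1) obtain d
    where "trans\<^sub>M M (subst_prog [x \<mapsto> d] Map.empty (subst_prog (\<sigma>(x := None)) \<tau> \<delta>)) s \<delta>' s'"
    by (auto simp: trans_PiO)
  \<comment> \<open>The two nested substitutions collapse into one, which makes the program an
    instance of the body again and brings it under the induction hypothesis.\<close>
  with closed_subst_PiO[OF cl, of d] PiO.IH show ?case
    unfolding subst_prog_comp by blast
next
  case (PiA x \<delta>)
  from PiA.prems have cl: "closed (PiA x (subst_prog \<sigma> (\<tau>(x := None)) \<delta>))"
    by simp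
  with PiA.prems(1) obtain \<beta> where "\<beta> \<in> ground_actions L"
    "trans\<^sub>M M (subst_prog Map.empty [x \<mapsto> \<beta>] (subst_prog \<sigma> (\<tau>(x := None)) \<delta>)) s \<delta>' s'"
    by (auto simp: trans_PiA)
  with closed_subst_PiA[OF cl, of \<beta>] PiA.IH show ?case
    unfolding subst_prog_comp by blast
next
  case (Star \<delta>)
  from Star.prems have "closed (subst_prog \<sigma> \<tau> \<delta>)"
    by simp
  with Star.prems Star.IH show ?case
    by (fastforce simp: trans_Star)
next
  case (Conc \<delta>\<^sub>1 \<delta>\<^sub>2)
  from Conc.prems have "closed (subst_prog \<sigma> \<tau> \<delta>\<^sub>1)" "closed (subst_prog \<sigma> \<tau> \<delta>\<^sub>2)"
    by simp_all
  with Conc.prems Conc.IH show ?case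
    by (fastforce simp: trans_Conc)
qed

lemma trans_closed_succ:
  "trans\<^sub>M M \<delta> s \<delta>' s' \<Longrightarrow> closed \<delta> \<Longrightarrow> closed \<delta>' \<and> succ s s'"
  using trans_subst_closed_succ[of Map.empty Map.empty \<delta>] by (simp add: subst_prog_empty)

section \<open>Runs and the situations they pass through\<close>

lemma trans_star_induct [consumes 1, case_names refl step]:
  assumes "trans_star M \<delta> s \<delta>' s'"
    and "P \<delta> s"
    and "\<And>\<delta>\<^sub>1 s\<^sub>1 \<delta>\<^sub>2 s\<^sub>2. trans_star M \<delta> s \<delta>\<^sub>1 s\<^sub>1 \<Longrightarrow> trans\<^sub>M M \<delta>\<^sub>1 s\<^sub>1 \<delta>\<^sub>2 s\<^sub>2 \<Longrightarrow> P \<delta>\<^sub>1 s\<^sub>1 \<Longrightarrow> P \<delta>\<^sub>2 s\<^sub>2"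
  shows "P \<delta>' s'"
  using assms(1) unfolding trans_star_def
  by (induction rule: rtranclp_induct2) (auto intro: assms(2,3)[unfolded trans_star_def])

lemma trans_star_refl: "trans_star M \<delta> s \<delta> s"
  by (simp add: trans_star_def)

lemma trans_star_step:
  "trans_star M \<delta> s \<delta>\<^sub>1 s\<^sub>1 \<Longrightarrow> trans\<^sub>M M \<delta>\<^sub>1 s\<^sub>1 \<delta>\<^sub>2 s\<^sub>2 \<Longrightarrow> trans_star M \<delta> s \<delta>\<^sub>2 s\<^sub>2"
  unfolding trans_star_def by (erule rtranclp.rtrancl_into_rtrancl) simp

lemma trans_star_closed_succ:
  assumes "trans_star M \<delta> s \<delta>' s'" "closed \<delta>"
  shows "closed \<delta>' \<and> succ\<^sup>*\<^sup>* s s'"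
  using assms(1)
proof (induction rule: trans_star_induct)
  case (step \<delta>\<^sub>1 s\<^sub>1 \<delta>\<^sub>2 s\<^sub>2)
  then show ?case
    using trans_closed_succ by (meson rtranclp.rtrancl_into_rtrancl)
qed (simp add: assms(2))

text \<open>A transition advances the situation by exactly one action, so a run cannot skip a
  situation lying between its start and its end.\<close>

lemma trans_star_through:
  assumes "trans_star M \<delta> s \<delta>' s'" "closed \<delta>" "succ\<^sup>*\<^sup>* s t" "succ\<^sup>*\<^sup>* t s'"
  shows "\<exists>\<delta>''. trans_star M \<delta> s \<delta>'' t"
  using assms(1,4)
proof (induction rule: trans_star_induct)
  case refl
  with assms(3) have "t = s"
    using succ_antisym by blast
  then show ?case
    using trans_star_refl by blast
next
  case (step \<delta>\<^sub>1 s\<^sub>1 \<delta>\<^sub>2 s\<^sub>2)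
  then obtain a where "s\<^sub>2 = do\<^sub>M M a s\<^sub>1"
    using trans_star_closed_succ[OF _ assms(2)] trans_closed_succ by (metis succ_def)
  \<comment> \<open>Either \<open>t\<close> is where the last transition arrives, or it already lies
    before that transition and the shorter run reaches it.\<close>
  with step.prems have "t = s\<^sub>2 \<or> succ\<^sup>*\<^sup>* t s\<^sub>1"
    using succ_rtranclp_do_cases by blast
  then show ?case
    using step trans_star_step by blast
qed

lemma Do_iff:
  "Do M \<delta> s e \<longleftrightarrow> s = e \<and> final\<^sub>M M \<delta> s \<or> (\<exists>\<delta>' s'. trans\<^sub>M M \<delta> s \<delta>' s' \<and> Do M \<delta>' s' e)"
  (is "?l \<longleftrightarrow> ?r")
proof
  assume ?l
  then show ?r
    unfolding Do_def trans_star_def by (auto elim: converse_rtranclpE)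
next
  assume ?r
  then show ?l
    unfolding Do_def trans_star_def by (auto intro: converse_rtranclp_into_rtranclp)
qed

lemma Do_final: "final\<^sub>M M \<delta> s \<Longrightarrow> Do M \<delta> s s"
  by (subst Do_iff) simp

lemma Do_trans: "trans\<^sub>M M \<delta> s \<delta>' s' \<Longrightarrow> Do M \<delta>' s' e \<Longrightarrow> Do M \<delta> s e"
  by (subst Do_iff) blast

text \<open>Induction from the front with a fixed end \<open>e\<close>: the program and the current
  situation vary, as needed to follow the syntactic form of the remaining program.\<close>

lemma Do_induct [consumes 1, case_names final trans]:
  assumes "Do M \<delta> s e"
    and "\<And>\<delta>. final\<^sub>M M \<delta> e \<Longrightarrow> P \<delta> e"
    and "\<And>\<delta> s \<delta>' s'. trans\<^sub>M M \<delta> s \<delta>' s' \<Longrightarrow> Do M \<delta>' s' e \<Longrightarrow> P \<delta>' s' \<Longrightarrow> P \<delta> s"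
  shows "P \<delta> s"
proof -
  obtain \<delta>\<^sub>e where "trans_star M \<delta> s \<delta>\<^sub>e e" and fin: "final\<^sub>M M \<delta>\<^sub>e e"
    using assms(1) by (auto simp: Do_def)
  from this(1) have "Do M \<delta> s e \<and> P \<delta> s"
    unfolding trans_star_def
    by (induction rule: converse_rtranclp_induct2) (use fin assms(2,3) Do_final Do_trans in auto)
  then show ?thesis ..
qed

lemma Do_succ: "Do M \<delta> s e \<Longrightarrow> closed \<delta> \<Longrightarrow> succ\<^sup>*\<^sup>* s e"
  unfolding Do_def using trans_star_closed_succ by blast

lemma Do_nil: "Do M nil s e \<longleftrightarrow> s = e"
  by (subst Do_iff) (auto simp: trans_Test final_Test[of _ _ undefined undefined])

section \<open>Splitting and joining runs of composite programs\<close>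

lemma Do_Seq_intro:
  assumes "Do M \<delta>\<^sub>1 s t" "Do M \<delta>\<^sub>2 t e" "closed \<delta>\<^sub>1" "closed \<delta>\<^sub>2"
  shows "Do M (Seq \<delta>\<^sub>1 \<delta>\<^sub>2) s e"
  using assms(1,3)
proof (induction rule: Do_induct)
  case (final \<delta>)
  \<comment> \<open>Once \<open>\<delta>\<close> is final, the sequence takes over termination or
    the first transition from \<open>\<delta>\<^sub>2\<close>.\<close>
  from assms(2) consider "t = e" "final\<^sub>M M \<delta>\<^sub>2 e"
    | \<delta>' s' where "trans\<^sub>M M \<delta>\<^sub>2 t \<delta>' s'" "Do M \<delta>' s' e"
    using Do_iff[of \<delta>\<^sub>2 t e] by blast
  then show ?case
    using final assms(4) by cases (auto intro: Do_final Do_trans simp: final_Seq trans_Seq)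
next
  case (trans \<delta> s \<delta>' s')
  then have "trans\<^sub>M M (Seq \<delta> \<delta>\<^sub>2) s (Seq \<delta>' \<delta>\<^sub>2) s'" "closed \<delta>'"
    using assms(4) trans_closed_succ by (auto simp: trans_Seq)
  with trans.IH show ?case
    by (blast intro: Do_trans)
qed

lemma Do_Seq_elim:
  assumes "Do M (Seq \<delta>\<^sub>1 \<delta>\<^sub>2) s e" "closed \<delta>\<^sub>1" "closed \<delta>\<^sub>2"
  shows "\<exists>t. Do M \<delta>\<^sub>1 s t \<and> Do M \<delta>\<^sub>2 t e"
  using assms
proof (induction "Seq \<delta>\<^sub>1 \<delta>\<^sub>2" s arbitrary: \<delta>\<^sub>1 rule: Do_induct)
  case final
  then show ?case
    using Do_final by (auto simp: final_Seq)
next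
  case (trans s \<delta>' s')
  then consider \<delta>\<^sub>1' where "trans\<^sub>M M \<delta>\<^sub>1 s \<delta>\<^sub>1' s'" "\<delta>' = Seq \<delta>\<^sub>1' \<delta>\<^sub>2"
    | "final\<^sub>M M \<delta>\<^sub>1 s" "trans\<^sub>M M \<delta>\<^sub>2 s \<delta>' s'"
    by (auto simp: trans_Seq)
  then show ?case
  proof cases
    case 1
    with trans show ?thesis
      using trans_closed_succ Do_trans by blast
  next
    case 2
    with trans show ?thesis
      using Do_trans Do_final by blast
  qed
qed

text \<open>\<open>seqs\<close> maps a one-element list to the bare program, without a trailing
  \<open>nil\<close>. The uniform splitting survives because \<open>nil\<close> always terminates
  and stays where it is.\<close>

lemma Do_seqs_Cons:
  assumes "closed \<delta>" "\<And>\<delta>'. \<delta>' \<in> set \<delta>s \<Longrightarrow> closed \<delta>'"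
  shows "Do M (seqs (\<delta> # \<delta>s)) s e \<longleftrightarrow> (\<exists>t. Do M \<delta> s t \<and> Do M (seqs \<delta>s) t e)"
proof (cases \<delta>s)
  case Nil
  then show ?thesis
    by (simp add: Do_nil)
next
  case (Cons \<delta>' \<delta>s')
  have "closed (seqs \<delta>s)"
    using assms(2) by (auto simp: closed_progs_def intro: wf_prog_seqs)
  with Cons assms(1) show ?thesis
    using Do_Seq_intro Do_Seq_elim by fastforce
qed

lemma Do_Star_elim:
  assumes "Do M (Star \<delta>) s e" "closed \<delta>"
  shows "(Do M \<delta>)\<^sup>*\<^sup>* s e"
proof -
  \<comment> \<open>After its first transition an iteration is a sequence of a partly executed body
    and the iteration, so both shapes are treated in one induction.\<close>
  have "(\<rho> = Star \<delta> \<longrightarrow> (Do M \<delta>)\<^sup>*\<^sup>* s e) \<and>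
      (\<forall>\<delta>'. \<rho> = Seq \<delta>' (Star \<delta>) \<longrightarrow> closed \<delta>' \<longrightarrow> (\<exists>t. Do M \<delta>' s t \<and> (Do M \<delta>)\<^sup>*\<^sup>* t e))"
    if "Do M \<rho> s e" for \<rho> s
    using that
  proof (induction rule: Do_induct)
    case (final \<rho>)
    then show ?case
      using assms(2) Do_final by (metis closed_simps(3,5) final_Seq rtranclp.rtrancl_refl)
  next
    case (trans \<rho> s \<rho>' s')
    \<comment> \<open>Stated for a transition of \<open>Star \<delta>\<close> rather than for
      \<open>\<rho>\<close>: it also serves a sequence whose first part is final, where the next
      round of the iteration begins.\<close>
    have loop: "(Do M \<delta>)\<^sup>*\<^sup>* s e" if star: "trans\<^sub>M M (Star \<delta>) s \<rho>' s'"
    proof -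
      obtain \<delta>' where \<delta>': "trans\<^sub>M M \<delta> s \<delta>' s'" "\<rho>' = Seq \<delta>' (Star \<delta>)"
        using star assms(2) by (auto simp: trans_Star)
      then obtain t where "Do M \<delta>' s' t" "(Do M \<delta>)\<^sup>*\<^sup>* t e"
        using trans.IH trans_closed_succ assms(2) by blast
      with \<delta>' show ?thesis
        using Do_trans by (meson converse_rtranclp_into_rtranclp)
    qed
    have "\<exists>t. Do M \<delta>' s t \<and> (Do M \<delta>)\<^sup>*\<^sup>* t e" if \<rho>: "\<rho> = Seq \<delta>' (Star \<delta>)" and cl: "closed \<delta>'" for \<delta>'
    proof -
      consider \<delta>'' where "trans\<^sub>M M \<delta>' s \<delta>'' s'" "\<rho>' = Seq \<delta>'' (Star \<delta>)"
        | "final\<^sub>M M \<delta>' s" "trans\<^sub>M M (Star \<delta>) s \<rho>' s'"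
        using trans.hyps(1) \<rho> cl assms(2) by (auto simp: trans_Seq)
      then show ?thesis
      proof cases
        case 1
        then show ?thesis
          using trans.IH trans_closed_succ cl Do_trans by blast
      next
        case 2
        then show ?thesis
          using loop Do_final by blast
      qed
    qed
    with loop trans.hyps(1) show ?case
      by blast
  qed
  with assms(1) show ?thesis
    by blast
qed

lemma Do_Choice_elim:
  "Do M (Choice \<delta>\<^sub>1 \<delta>\<^sub>2) s e \<Longrightarrow> closed \<delta>\<^sub>1 \<Longrightarrow> closed \<delta>\<^sub>2 \<Longrightarrow> Do M \<delta>\<^sub>1 s e \<or> Do M \<delta>\<^sub>2 s e"
  using Do_iff[of "Choice \<delta>\<^sub>1 \<delta>\<^sub>2" s e]
  by (simp add: trans_Choice final_Choice) (blast intro: Do_trans Do_final)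

lemma Do_choices_elim:
  "Do M (choices \<delta>s) s e \<Longrightarrow> (\<And>\<delta>. \<delta> \<in> set \<delta>s \<Longrightarrow> closed \<delta>) \<Longrightarrow> \<exists>\<delta>\<in>set \<delta>s. Do M \<delta> s e"
proof (induction \<delta>s rule: choices.induct)
  case 1
  then show ?case
    \<comment> \<open>The empty choice is a test that always fails: it has neither a transition nor
      a final situation.\<close>
    using trans_Test[of "Neg Tru"] final_Test[of "Neg Tru"] Do_iff[of "Test (Neg Tru)" s e] by simp
next
  case (3 \<delta> \<delta>' \<delta>s)
  have "closed (choices (\<delta>' # \<delta>s))"
    using 3(3) unfolding closed_progs_def by (metis list.set_intros(2) mem_Collect_eq wf_prog_choices)
  then have "Do M \<delta> s e \<or> Do M (choices (\<delta>' # \<delta>s)) s e"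
    using 3(2,3) Do_Choice_elim by simp
  then show ?case
    using 3(1) 3(3) by (meson list.set_intros)
qed simp

lemma Do_PiO_elim:
  "Do M (PiO x \<delta>) s e \<Longrightarrow> closed (PiO x \<delta>) \<Longrightarrow> \<exists>d. Do M (subst_prog [x \<mapsto> d] Map.empty \<delta>) s e"
  using Do_iff[of "PiO x \<delta>" s e]
  by (simp add: trans_PiO final_PiO) (blast intro: Do_trans Do_final)

text \<open>\<open>\<sigma>\<close> accumulates the objects picked so far. Distinct variables
  outside its domain ensure that no inner binder undoes an earlier pick.\<close>

lemma Do_foldr_PiO_elim:
  assumes "Do M (subst_prog \<sigma> Map.empty (foldr PiO xs \<delta>)) s e"
    and "closed (subst_prog \<sigma> Map.empty (foldr PiO xs \<delta>))"
    and "distinct xs" "dom \<sigma> \<inter> set xs = {}"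
  shows "\<exists>\<sigma>'. dom \<sigma>' = dom \<sigma> \<union> set xs \<and> Do M (subst_prog \<sigma>' Map.empty \<delta>) s e"
  using assms
proof (induction xs arbitrary: \<sigma>)
  case (Cons x xs)
  \<comment> \<open>Passing under the binder leaves \<open>\<sigma>\<close> unchanged, because
    \<open>x\<close> is not yet assigned.\<close>
  have \<sigma>: "\<sigma>(x := None) = \<sigma>"
    using Cons.prems(4) by (auto simp: fun_eq_iff)
  with Cons.prems have cl: "closed (PiO x (subst_prog \<sigma> Map.empty (foldr PiO xs \<delta>)))"
    by simp
  moreover have "Do M (PiO x (subst_prog \<sigma> Map.empty (foldr PiO xs \<delta>))) s e"
    using Cons.prems(1) \<sigma> by simp
  ultimately obtain d
    where "Do M (subst_prog [x \<mapsto> d] Map.empty (subst_prog \<sigma> Map.empty (foldr PiO xs \<delta>))) s e"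
    using Do_PiO_elim by blast
  with closed_subst_PiO[OF cl, of d] Cons.IH[of "[x \<mapsto> d] ++ \<sigma>"] Cons.prems(3,4)
  obtain \<sigma>' where "dom \<sigma>' = dom ([x \<mapsto> d] ++ \<sigma>) \<union> set xs" "Do M (subst_prog \<sigma>' Map.empty \<delta>) s e"
    by (auto simp: subst_prog_comp)
  then show ?case
    by (intro exI[of _ \<sigma>']) auto
qed auto

lemma Do_pis_elim:
  assumes "Do M (pis k \<delta>) s e" "closed (pis k \<delta>)"
  shows "\<exists>ds. length ds = k \<and> Do M (inst_prog ds \<delta>) s e"
proof -
  obtain \<sigma> where \<sigma>: "dom \<sigma> = {..<k}" "Do M (subst_prog \<sigma> Map.empty \<delta>) s e"
    using Do_foldr_PiO_elim[of Map.empty "[0..<k]" \<delta> s e] assms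
    by (auto simp: pis_def subst_prog_empty atLeast0LessThan)
  \<comment> \<open>The arguments are read off the accumulated substitution; its domain is exactly
    the variables below \<open>k\<close>, so \<open>the\<close> is never applied to
    \<open>None\<close>.\<close>
  define ds where "ds = map (the \<circ> \<sigma>) [0..<k]"
  have "(\<lambda>x. if x < length ds then Some (ds ! x) else None) = \<sigma>"
  proof
    fix x
    have "x < k \<longleftrightarrow> (\<exists>d. \<sigma> x = Some d)"
      using \<sigma>(1) by (auto simp: dom_def)
    then show "(if x < length ds then Some (ds ! x) else None) = \<sigma> x"
      by (cases "\<sigma> x") (auto simp: ds_def)
  qed
  then have "inst_prog ds \<delta> = subst_prog \<sigma> Map.empty \<delta>"
    by (simp only: inst_prog_def)
  moreover have "length ds = k"
    by (simp add: ds_def)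
  ultimately show ?thesis
    using \<sigma>(2) by metis
qed

section \<open>Uniqueness of the decomposition into high-level actions\<close>

lemma Do_seqs_unique:
  assumes closed: "\<And>\<alpha>. \<alpha> \<in> G \<Longrightarrow> closed (p \<alpha>)"
    and a: "\<And>\<alpha> \<alpha>' s s' \<delta>. \<alpha> \<in> G \<Longrightarrow> \<alpha>' \<in> G \<Longrightarrow> \<alpha> \<noteq> \<alpha>' \<Longrightarrow> Do M (p \<alpha>) s s' \<Longrightarrow>
      \<not> trans_star M (p \<alpha>') s \<delta> s'"
    and b: "\<And>\<alpha> s s' a \<delta>. \<alpha> \<in> G \<Longrightarrow> Do M (p \<alpha>) s s' \<Longrightarrow> \<not> trans_star M (p \<alpha>) s \<delta> (do\<^sub>M M a s')"
    and c: "\<And>\<alpha> s s'. \<alpha> \<in> G \<Longrightarrow> Do M (p \<alpha>) s s' \<Longrightarrow> exec_less M s s'"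
    and "set \<alpha>s \<subseteq> G" "set \<beta>s \<subseteq> G" "Do M (seqs (map p \<alpha>s)) s e" "Do M (seqs (map p \<beta>s)) s e"
  shows "\<alpha>s = \<beta>s"
proof -
  \<comment> \<open>Condition \<open>c\<close> makes the first piece advance strictly; the remainder
    can only move further towards \<open>e\<close>.\<close>
  have split_run: "\<exists>t. Do M (p \<alpha>) s t \<and> Do M (seqs (map p \<alpha>s)) t e \<and> succ\<^sup>+\<^sup>+ s t \<and> succ\<^sup>*\<^sup>* t e"
    if G: "set (\<alpha> # \<alpha>s) \<subseteq> G" and run: "Do M (seqs (map p (\<alpha> # \<alpha>s))) s e" for \<alpha> \<alpha>s s
  proof -
    have cl: "closed \<delta>'" if "\<delta>' \<in> set (map p (\<alpha> # \<alpha>s))" for \<delta>'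
      using that G closed by auto
    then have "closed (seqs (map p \<alpha>s))"
      by (auto simp: closed_progs_def intro!: wf_prog_seqs)
    moreover obtain t where "Do M (p \<alpha>) s t" "Do M (seqs (map p \<alpha>s)) t e"
      using run Do_seqs_Cons[of "p \<alpha>" "map p \<alpha>s"] cl by auto
    ultimately show ?thesis
      using c exec_less_succ Do_succ G by (meson list.set_intros(1) subsetD)
  qed
  \<comment> \<open>This rules out that one list ends while the other still has actions
    left.\<close>
  have no_return: False if "set (\<alpha> # \<alpha>s) \<subseteq> G" "Do M (seqs (map p (\<alpha> # \<alpha>s))) e e" for \<alpha> \<alpha>s
    using split_run[OF that] succ_acyclic by (meson tranclp_rtranclp_tranclp)
  have first: "\<alpha> = \<beta> \<and> t = u"
    if G: "\<alpha> \<in> G" "\<beta> \<in> G" and Do: "Do M (p \<alpha>) s t" "Do M (p \<beta>) s u" and "succ\<^sup>*\<^sup>* t u"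
    for \<alpha> \<beta> s t u
  proof -
    obtain \<delta> where run: "trans_star M (p \<beta>) s \<delta> u"
      using Do(2) by (auto simp: Do_def)
    have "succ\<^sup>*\<^sup>* s t"
      using Do_succ Do(1) closed G(1) by blast
    \<comment> \<open>The run of \<open>p \<beta>\<close> passes through \<open>t\<close>, where
      \<open>p \<alpha>\<close> completes; by \<open>a\<close> this is impossible for distinct
      actions.\<close>
    then have "\<alpha> = \<beta>"
      using trans_star_through[OF run] closed a G Do(1) \<open>succ\<^sup>*\<^sup>* t u\<close> by blast
    moreover have "t = u"
    proof (rule ccontr)
      assume "t \<noteq> u"
      \<comment> \<open>\<open>a\<close> is the first action after \<open>t\<close> on the way to
        \<open>u\<close>. The run to \<open>u\<close> passes through its result, so the program that
        may stop at \<open>t\<close> could also go one action beyond, against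
        \<open>b\<close>.\<close>
      with \<open>succ\<^sup>*\<^sup>* t u\<close> obtain a where "succ\<^sup>*\<^sup>* (do\<^sub>M M a t) u"
        by (metis converse_rtranclpE succ_def)
      moreover have "succ\<^sup>*\<^sup>* s (do\<^sub>M M a t)"
        using \<open>succ\<^sup>*\<^sup>* s t\<close> by (rule rtranclp.rtrancl_into_rtrancl) (auto simp: succ_def)
      ultimately show False
        using trans_star_through[OF run] closed b G(2) Do(1) \<open>\<alpha> = \<beta>\<close> by blast
    qed
    ultimately show ?thesis ..
  qed
  show ?thesis
    using assms(5-)
  proof (induction \<alpha>s arbitrary: s \<beta>s)
    case Nil
    then show ?case
      using no_return by (cases \<beta>s) (auto simp: Do_nil)
  next
    case (Cons \<alpha> \<alpha>s)
    \<comment> \<open>An empty \<open>\<beta>s\<close> would force \<open>s = e\<close>, and then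
      the nonempty list would return to its start.\<close>
    obtain \<beta> \<beta>s' where \<beta>s: "\<beta>s = \<beta> # \<beta>s'"
      using no_return Cons.prems by (cases \<beta>s) (auto simp: Do_nil)
    obtain t where t: "Do M (p \<alpha>) s t" "Do M (seqs (map p \<alpha>s)) t e" "succ\<^sup>*\<^sup>* t e"
      using split_run[OF Cons.prems(1,3)] by blast
    obtain u where u: "Do M (p \<beta>) s u" "Do M (seqs (map p \<beta>s')) u e" "succ\<^sup>*\<^sup>* u e"
      using split_run Cons.prems(2,4) unfolding \<beta>s by blast
    \<comment> \<open>Which of the two first actions completes earlier is unknown, so
      \<open>first\<close> is supplied in both orientations.\<close>
    have "\<alpha> = \<beta> \<and> t = u"
      using succ_linear[OF t(3) u(3)] first[OF _ _ t(1) u(1)] first[OF _ _ u(1) t(1)] Cons.prems(1,2) \<beta>s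
      by auto
    with Cons.IH[of \<beta>s' t] Cons.prems(1,2) t(2) u(2) \<beta>s show ?case
      by auto
  qed
qed

end

section \<open>Existence of a decomposition, and the combined result\<close>

lemma den_map_actions:
  "den_prog M (map_actions m \<alpha>s) = seqs (map (den_prog M \<circ> map_action m) \<alpha>s)"
  by (simp add: den_prog_def map_actions_def map_seqs)

text \<open>Each round of the iteration yields one ground action: the choice supplies its type, the
  picked objects its arguments. The actions are then concatenated along the chain of rounds.\<close>

lemma Do_anyseqhl_map_actions:
  fixes M :: "('n, 'al, 'fl, 'o, 'a, 's) struct"
    and m :: "('n, 'ah, 'fh, 'al, 'fl) mapping"
  assumes "congolog_model M L" "sat_coa M"
    and wf: "\<And>A. A \<in> set (act_types L\<^sub>h) \<Longrightarrow> wf_prog L {..<act_arity L\<^sub>h A} {} (m_act m A)"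
    and Do: "Do M (den_prog M (anyseqhl L\<^sub>h m)) s e"
  shows "\<exists>\<alpha>s. set \<alpha>s \<subseteq> ground_actions L\<^sub>h \<and> Do M (den_prog M (map_actions m \<alpha>s)) s e"
proof -
  interpret congolog_model M L
    by fact
  let ?den = "map_prog (con\<^sub>M M) id id"
  let ?p = "\<lambda>A. pis (act_arity L\<^sub>h A) (?den (m_act m A))"
  have any1: "?den (any1hl L\<^sub>h m) = choices (map ?p (act_types L\<^sub>h))"
    by (simp add: any1hl_def map_choices pis_def map_foldr_PiO comp_def)
  have closed_p: "closed (?p A)" if "A \<in> set (act_types L\<^sub>h)" for A
    using wf[OF that] by (simp add: closed_progs_def pis_def wf_prog_foldr_PiO wf_prog_map atLeast0LessThan)
  have select: "\<exists>\<alpha>\<in>ground_actions L\<^sub>h. Do M (?den (map_action m \<alpha>)) s t"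
    if body: "Do M (?den (any1hl L\<^sub>h m)) s t" for s t
  proof -
    obtain A where A: "A \<in> set (act_types L\<^sub>h)" "Do M (?p A) s t"
      using Do_choices_elim[OF body[unfolded any1]] closed_p by auto
    then obtain ds where ds: "length ds = act_arity L\<^sub>h A" "Do M (inst_prog ds (?den (m_act m A))) s t"
      using Do_pis_elim closed_p by blast
    \<comment> \<open>Domain closure: the picked objects are all denoted by standard names, which
      turns the object tuple into arguments of a ground term.\<close>
    have "ds \<in> lists (range (con\<^sub>M M))"
      using \<open>sat_coa M\<close> unfolding sat_coa_def by blast
    then obtain ns where "ds = map (con\<^sub>M M) ns"
      by (auto simp: lists_image)
    with A(1) ds show ?thesis
      by (intro bexI[of _ "(A, ns)"]) (auto simp: map_action_def map_inst_prog ground_actions_def)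
  qed
  have closed_map: "closed (?den (map_action m \<alpha>))" if "\<alpha> \<in> ground_actions L\<^sub>h" for \<alpha>
    using that wf
    by (auto simp: ground_actions_def map_action_def map_inst_prog wf_prog_map intro!: closed_inst_prog)
  have "closed (?den (any1hl L\<^sub>h m))"
    unfolding any1 using closed_p by (auto simp: closed_progs_def intro!: wf_prog_choices)
  with Do have "(Do M (?den (any1hl L\<^sub>h m)))\<^sup>*\<^sup>* s e"
    by (intro Do_Star_elim) (simp_all add: den_prog_def anyseqhl_def)
  then have "\<exists>\<alpha>s. set \<alpha>s \<subseteq> ground_actions L\<^sub>h \<and> Do M (seqs (map (?den \<circ> map_action m) \<alpha>s)) s e"
  proof (induction rule: converse_rtranclp_induct)
    case base
    show ?case
      by (intro exI[of _ "[]"]) (simp add: Do_nil)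
  next
    case (step s t)
    then obtain \<alpha> \<alpha>s where "\<alpha> \<in> ground_actions L\<^sub>h" "Do M (?den (map_action m \<alpha>)) s t"
      "set \<alpha>s \<subseteq> ground_actions L\<^sub>h" "Do M (seqs (map (?den \<circ> map_action m) \<alpha>s)) t e"
      using select by meson
    then have "Do M (seqs (map (?den \<circ> map_action m) (\<alpha> # \<alpha>s))) s e"
      unfolding list.map comp_apply by (subst Do_seqs_Cons) (auto intro: closed_map simp: comp_def)
    moreover have "set (\<alpha> # \<alpha>s) \<subseteq> ground_actions L\<^sub>h"
      using \<open>\<alpha> \<in> ground_actions L\<^sub>h\<close> \<open>set \<alpha>s \<subseteq> ground_actions L\<^sub>h\<close> by simp
    ultimately show ?case
      by blast
  qed
  then show ?thesis
    unfolding den_map_actions unfolding den_prog_def .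
qed

theorem theorem9:
  fixes D\<^sub>h :: "('n::{countable, infinite}, 'ah, 'fh) bat"
    and D\<^sub>l :: "('n, 'al, 'fl) bat"
    and m :: "('n, 'ah, 'fh, 'al, 'fl) mapping"
    and M\<^sub>l :: "('n, 'al, 'fl, 'o, 'a, 's) struct"
    and S\<^sub>s S\<^sub>e :: "('n, 'al) gsit"
  assumes "wf_bat D\<^sub>h" and "wf_bat D\<^sub>l"
    and "refinement_mapping TYPE(('n, 'al, 'fl, 'o, 'a, 's) struct) D\<^sub>h D\<^sub>l m"
    and a: "\<And>\<alpha> \<alpha>'. \<alpha> \<in> ground_actions (lang D\<^sub>h) \<Longrightarrow> \<alpha>' \<in> ground_actions (lang D\<^sub>h) \<Longrightarrow> \<alpha> \<noteq> \<alpha>' \<Longrightarrow>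
        entails_with_congolog D\<^sub>l (\<lambda>M :: ('n, 'al, 'fl, 'o, 'a, 's) struct.
          \<forall>s s'. Do M (den_prog M (map_action m \<alpha>)) s s' \<longrightarrow>
            \<not> (\<exists>\<delta>. trans_star M (den_prog M (map_action m \<alpha>')) s \<delta> s'))"
    and b: "\<And>\<alpha>. \<alpha> \<in> ground_actions (lang D\<^sub>h) \<Longrightarrow>
        entails_with_congolog D\<^sub>l (\<lambda>M :: ('n, 'al, 'fl, 'o, 'a, 's) struct.
          \<forall>s s'. Do M (den_prog M (map_action m \<alpha>)) s s' \<longrightarrow>
            \<not> (\<exists>a \<delta>. trans_star M (den_prog M (map_action m \<alpha>)) s \<delta> (do\<^sub>M M a s')))"
    and c: "\<And>\<alpha>. \<alpha> \<in> ground_actions (lang D\<^sub>h) \<Longrightarrow>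
        entails_with_congolog D\<^sub>l (\<lambda>M :: ('n, 'al, 'fl, 'o, 'a, 's) struct.
          \<forall>s s'. Do M (den_prog M (map_action m \<alpha>)) s s' \<longrightarrow> exec_less M s s')"
    and "model_with_congolog D\<^sub>l M\<^sub>l"
    and "ground_sit (lang D\<^sub>l) S\<^sub>s" and "ground_sit (lang D\<^sub>l) S\<^sub>e"
    and "Do M\<^sub>l (den_prog M\<^sub>l (anyseqhl (lang D\<^sub>h) m)) (den_sit M\<^sub>l S\<^sub>s) (den_sit M\<^sub>l S\<^sub>e)"
  shows "\<exists>!\<alpha>s. set \<alpha>s \<subseteq> ground_actions (lang D\<^sub>h) \<and>
           Do M\<^sub>l (den_prog M\<^sub>l (map_actions m \<alpha>s)) (den_sit M\<^sub>l S\<^sub>s) (den_sit M\<^sub>l S\<^sub>e)"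
proof -
  let ?G = "ground_actions (lang D\<^sub>h)"
  let ?p = "den_prog M\<^sub>l \<circ> map_action m"
  have wf: "wf_prog (lang D\<^sub>l) {..<act_arity (lang D\<^sub>h) A} {} (m_act m A)"
    if "A \<in> set (act_types (lang D\<^sub>h))" for A
    using assms(3) that by (auto simp: refinement_mapping_def)
  have bat: "sat_bat D\<^sub>l M\<^sub>l" and cong: "sat_congolog (lang D\<^sub>l) M\<^sub>l"
    using \<open>model_with_congolog D\<^sub>l M\<^sub>l\<close> by (auto simp: model_with_congolog_def)
  then interpret congolog_model M\<^sub>l "lang D\<^sub>l"
    by unfold_locales (auto simp: sat_bat_def)
  \<comment> \<open>The entailed conditions concern structures with the domain types of
    \<open>M\<^sub>l\<close>, so each can be specialised to this model.\<close>
  have holds: "\<Phi> M\<^sub>l" if "entails_with_congolog D\<^sub>l \<Phi>" for \<Phi>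
    using that \<open>model_with_congolog D\<^sub>l M\<^sub>l\<close> by (auto simp: entails_with_congolog_def)
  have "\<exists>\<alpha>s. set \<alpha>s \<subseteq> ?G \<and>
      Do M\<^sub>l (den_prog M\<^sub>l (map_actions m \<alpha>s)) (den_sit M\<^sub>l S\<^sub>s) (den_sit M\<^sub>l S\<^sub>e)"
    using Do_anyseqhl_map_actions[OF congolog_model_axioms _ wf] bat assms(10)
    by (auto simp: sat_bat_def)
  moreover have "\<alpha>s = \<beta>s"
    if "set \<alpha>s \<subseteq> ?G" "Do M\<^sub>l (den_prog M\<^sub>l (map_actions m \<alpha>s)) s e"
      "set \<beta>s \<subseteq> ?G" "Do M\<^sub>l (den_prog M\<^sub>l (map_actions m \<beta>s)) s e" for \<alpha>s \<beta>s s e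
  proof (rule Do_seqs_unique[of ?G ?p _ _ s e])
    show "closed (?p \<alpha>)" if "\<alpha> \<in> ?G" for \<alpha>
      using that wf
      by (auto simp: ground_actions_def map_action_def den_prog_def map_inst_prog wf_prog_map
          intro!: closed_inst_prog)
    show "\<not> trans_star M\<^sub>l (?p \<alpha>') s \<delta> s'"
      if "\<alpha> \<in> ?G" "\<alpha>' \<in> ?G" "\<alpha> \<noteq> \<alpha>'" "Do M\<^sub>l (?p \<alpha>) s s'" for \<alpha> \<alpha>' s s' \<delta>
      using holds[OF a[OF that(1-3)]] that(4) by auto
    show "\<not> trans_star M\<^sub>l (?p \<alpha>) s \<delta> (do\<^sub>M M\<^sub>l a s')"
      if "\<alpha> \<in> ?G" "Do M\<^sub>l (?p \<alpha>) s s'" for \<alpha> s s' a \<delta>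
      using holds[OF b[OF that(1)]] that(2) by auto
    show "exec_less M\<^sub>l s s'" if "\<alpha> \<in> ?G" "Do M\<^sub>l (?p \<alpha>) s s'" for \<alpha> s s'
      using holds[OF c[OF that(1)]] that(2) by auto
  qed (use that in \<open>simp_all only: den_map_actions\<close>)
  ultimately show ?thesis
    by blast
qed

end
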